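(* (Direct part.) Let $D:f=0$ be a nearly free surface in $\mathbb{P}^3$ which is not a cone, with exponents $d_1\le d_2\le d_3$. Let $r_1,r_2,r_3,r_4$ be homogeneous generators of $AR(f)$ of degrees $d_1,d_2,d_3,d_3$ and let $$a_1r_1+a_2r_2+a_3r_3+a_4r_4=0$$ be the (unique up to a nonzero constant) homogeneous relation generating the module of second order syzygies, where $a_1,a_2,a_3,a_4\in S$ are homogeneous of degrees $d_3-d_1+1,\ d_3-d_2+1,\ 1,\ 1$. Let $r_0=(x,y,z,w)$. For $i=1,2,3,4$ let $\phi_i$ be the determinant of the $4\times 4$ matrix whose rows are, in order, $r_0,\dots,r_{i-1},r_{i+1},\dots,r_4$. Then there is a nonzero constant $c\in\mathbb{C}$ such that $$\phi_i=(-1)^i\,c\,a_i\,f\qquad\text{for } i=1,2,3,4.$$ (Converse part.) Let $D:f=0$ be a reduced surface of degree $d$ in $\mathbb{P}^3$ which is not a cone and assume that (i) the Jacobian ideal $J_f$ is saturated (with respect to the ideal $(x,y,z,w)$); (ii) the module $AR(f)$ has a set of minimal homogeneous generators $r_1,r_2,r_3,r_4$ of degrees $d_1\leq d_2\leq d_3=d_4$ such that $d_1+d_2+d_3=d$. Then $D$ is a nearly free surface, and the coefficients $a_i$ of the generating second order syzygy $a_1r_1+a_2r_2+a_3r_3+a_4r_4=0$ can be taken to be $a_i=(-1)^i\phi_i/f$ for $i=1,\dots,4$, where $\phi_i$ is defined from $r_0,r_1,\dots,r_4$ by the same determinants as in the direct part.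
   Context: $S=\mathbb{C}[x,y,z,w]$ with the standard grading; $f\in S$ is homogeneous of degree $d$; $J_f$ is the ideal generated by the partial derivatives $f_x,f_y,f_z,f_w$; $M(f)=S/J_f$. $AR(f)=\{(b_0,b_1,b_2,b_3)\in S^4: b_0f_x+b_1f_y+b_2f_z+b_3f_w=0\}$, graded by the degree of the components. $D$ is a cone if, after a linear change of coordinates, $f$ does not depend on one of the variables. A reduced surface $D:f=0$ of degree $d$ in $\mathbb{P}^3$ that is not a cone is called nearly free with exponents $1\le d_1\le d_2\le d_3$ if the minimal graded free resolution of $M(f)$ has the form $$0\to S(-d_3-d)\to S(-d_1-(d-1))\oplus S(-d_2-(d-1))\oplus S(-d_3-(d-1))^2\to S(-(d-1))^4\to S.$$ Equivalently, $AR(f)$ is minimally generated by four homogeneous elements $r_1,r_2,r_3,r_4$ of degrees $d_1,d_2,d_3,d_3$, and the module of relations among them is free of rank one, generated by a single relation $a_1r_1+a_2r_2+a_3r_3+a_4r_4=0$ with $a_i$ homogeneous of degrees $d_3-d_1+1,d_3-d_2+1,1,1$. *)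

theory Defs
  imports
    "HOL-Analysis.Analysis"
    "HOL-Library.Poly_Mapping"
    "HOL-Computational_Algebra.Squarefree"
begin

section \<open>The polynomial ring in four variables\<close>

text \<open>
  A polynomial is a finitely supported family of coefficients indexed by monomials, a monomial
  being a family of exponents. The four variables are indexed by the type \<open>4\<close> and written
  \<open>1, 2, 3, 4\<close>, in the order in which \<open>vector\<close> enumerates the entries of
  a vector (the numeral \<open>4 :: 4\<close> coincides with \<open>0\<close>).
\<close>

type_synonym S = "(4 \<Rightarrow>\<^sub>0 nat) \<Rightarrow>\<^sub>0 complex"

definition Const :: "complex \<Rightarrow> S" where
  "Const c = Poly_Mapping.single 0 c"

definition Var :: "4 \<Rightarrow> S" where
  "Var i = Poly_Mapping.single (Poly_Mapping.single i 1) 1"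

definition mdeg :: "(4 \<Rightarrow>\<^sub>0 nat) \<Rightarrow> nat" where
  "mdeg m = (\<Sum>i\<in>UNIV. Poly_Mapping.lookup m i)"

text \<open>
  Degrees are integers because the entries of graded maps have degrees that are differences of
  shifts. The zero polynomial is homogeneous of every degree, and it is the only polynomial that is
  homogeneous of a negative degree.
\<close>

definition homogeneous :: "int \<Rightarrow> S \<Rightarrow> bool" where
  "homogeneous k p \<longleftrightarrow> (\<forall>m\<in>Poly_Mapping.keys p. int (mdeg m) = k)"

definition homogeneous_vec :: "int \<Rightarrow> S^4 \<Rightarrow> bool" where
  "homogeneous_vec k v \<longleftrightarrow> (\<forall>i. homogeneous k (v $ i))"

text \<open>
  Terms whose monomial does not contain the variable \<open>i\<close> get the coefficient \<open>0\<close>, so the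
  truncated subtraction of exponents is harmless.
\<close>

definition pdiff :: "4 \<Rightarrow> S \<Rightarrow> S" where
  "pdiff i p = (\<Sum>m\<in>Poly_Mapping.keys p.
     Poly_Mapping.single (m - Poly_Mapping.single i 1)
       (of_nat (Poly_Mapping.lookup m i) * Poly_Mapping.lookup p m))"

definition subst :: "(4 \<Rightarrow> S) \<Rightarrow> S \<Rightarrow> S" where
  "subst \<sigma> p = (\<Sum>m\<in>Poly_Mapping.keys p.
     Const (Poly_Mapping.lookup p m) * (\<Prod>i\<in>UNIV. \<sigma> i ^ Poly_Mapping.lookup m i))"

definition linear_change :: "complex^4^4 \<Rightarrow> S \<Rightarrow> S" where
  "linear_change A = subst (\<lambda>i. \<Sum>j\<in>UNIV. Const (A $ i $ j) * Var j)"


section \<open>Ideals and submodules of free modules\<close>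

text \<open>
  \<open>module.span (*)\<close> is the ideal generated by a set of polynomials and
  \<open>module.span (*s)\<close> the submodule generated by a set of vectors.
\<close>

lemma module_S: "module ((*) :: S \<Rightarrow> S \<Rightarrow> S)"
  by unfold_locales (simp_all add: algebra_simps)

lemma module_S_vec: "module ((*s) :: S \<Rightarrow> S^'n \<Rightarrow> S^'n)"
  by unfold_locales (simp_all add: vec_eq_iff algebra_simps)

lemma vector_4:
  "(vector [x, y, z, w] :: 'a::zero^4) $ 1 = x"
  "(vector [x, y, z, w] :: 'a::zero^4) $ 2 = y"
  "(vector [x, y, z, w] :: 'a::zero^4) $ 3 = z"
  "(vector [x, y, z, w] :: 'a::zero^4) $ 4 = w"
  unfolding vector_def by simp_all

definition irrelevant_ideal :: "S set" where
  "irrelevant_ideal = module.span (*) (range Var)"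

primrec ideal_power :: "S set \<Rightarrow> nat \<Rightarrow> S set" where
  "ideal_power I 0 = UNIV"
| "ideal_power I (Suc k) = module.span (*) {p * q | p q. p \<in> I \<and> q \<in> ideal_power I k}"

definition saturated :: "S set \<Rightarrow> bool" where
  "saturated I \<longleftrightarrow>
     {g. \<exists>k. \<forall>h\<in>ideal_power irrelevant_ideal k. h * g \<in> I} = I"

definition jacobian_ideal :: "S \<Rightarrow> S set" where
  "jacobian_ideal f = module.span (*) (range (\<lambda>i. pdiff i f))"

definition AR :: "S \<Rightarrow> (S^4) set" where
  "AR f = {b. (\<Sum>i\<in>UNIV. b $ i * pdiff i f) = 0}"

definition generates_AR :: "S \<Rightarrow> (nat \<Rightarrow> S^4) \<Rightarrow> bool" where
  "generates_AR f r \<longleftrightarrow> module.span (*s) (r ` {1..4}) = AR f"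

definition minimally_generates_AR :: "S \<Rightarrow> (nat \<Rightarrow> S^4) \<Rightarrow> bool" where
  "minimally_generates_AR f r \<longleftrightarrow>
     generates_AR f r \<and> (\<forall>i\<in>{1..4}. r i \<notin> module.span (*s) (r ` ({1..4} - {i})))"

definition generates_relations :: "(nat \<Rightarrow> S^4) \<Rightarrow> (nat \<Rightarrow> S) \<Rightarrow> bool" where
  "generates_relations r a \<longleftrightarrow>
     (\<forall>b. (\<Sum>i=1..4. b i *s r i) = 0 \<longleftrightarrow> (\<exists>g. \<forall>i\<in>{1..4}. b i = g * a i))"


section \<open>Minimal graded free resolutions\<close>

text \<open>
  A vector \<open>e :: int^'n\<close> of shifts stands for the graded free module
  \<open>\<Oplus>\<^sub>j S(- e\<^sub>j)\<close>, whose \<open>j\<close>-th basis element has degree \<open>e\<^sub>j\<close>. A matrix defines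
  a homomorphism of degree \<open>0\<close> from the module with shifts \<open>e'\<close> to the one with shifts \<open>e\<close>
  precisely when its entry at row \<open>i\<close> and column \<open>j\<close> is homogeneous of
  degree \<open>e'\<^sub>j - e\<^sub>i\<close>.
\<close>

definition graded_map :: "int^'m \<Rightarrow> int^'n \<Rightarrow> S^'n^'m \<Rightarrow> bool" where
  "graded_map e e' A \<longleftrightarrow> (\<forall>i j. homogeneous (e' $ j - e $ i) (A $ i $ j))"

definition minimal_map :: "S^'n^'m \<Rightarrow> bool" where
  "minimal_map A \<longleftrightarrow> (\<forall>i j. A $ i $ j \<in> irrelevant_ideal)"

text \<open>
  The minimal graded free resolution of \<open>S/I\<close> has the form
  \<open>0 \<rightarrow> F\<^sub>3 \<rightarrow> F\<^sub>2 \<rightarrow> F\<^sub>1 \<rightarrow> S\<close>, where \<open>F\<^sub>k\<close> has shifts \<open>e\<^sub>k\<close>. Since \<open>I\<close> is the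
  kernel of the augmentation from \<open>S\<close> to \<open>S/I\<close>, exactness at \<open>S\<close> says that
  the image of the first map is \<open>I\<close>.
\<close>

definition has_minimal_resolution ::
  "S set \<Rightarrow> int^'n1 \<Rightarrow> int^'n2 \<Rightarrow> int^'n3 \<Rightarrow> bool" where
  "has_minimal_resolution I e1 e2 e3 \<longleftrightarrow>
     (\<exists>(A1 :: S^'n1^1) (A2 :: S^'n2^'n1) (A3 :: S^'n3^'n2).
        graded_map 0 e1 A1 \<and> graded_map e1 e2 A2 \<and> graded_map e2 e3 A3 \<and>
        minimal_map A1 \<and> minimal_map A2 \<and> minimal_map A3 \<and>
        range (\<lambda>u. (A1 *v u) $ 1) = I \<and>
        {u. A1 *v u = 0} = range (\<lambda>v. A2 *v v) \<and>
        {u. A2 *v u = 0} = range (\<lambda>v. A3 *v v) \<and>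
        inj (\<lambda>v. A3 *v v))"


section \<open>Nearly free surfaces\<close>

definition reduced_surface :: "S \<Rightarrow> nat \<Rightarrow> bool" where
  "reduced_surface f d \<longleftrightarrow> f \<noteq> 0 \<and> d \<ge> 1 \<and> homogeneous (int d) f \<and> squarefree f"

definition is_cone :: "S \<Rightarrow> bool" where
  "is_cone f \<longleftrightarrow>
     (\<exists>A i. invertible A \<and>
        (\<forall>m\<in>Poly_Mapping.keys (linear_change A f). Poly_Mapping.lookup m i = 0))"

definition nearly_free :: "S \<Rightarrow> nat \<Rightarrow> nat \<Rightarrow> nat \<Rightarrow> nat \<Rightarrow> bool" where
  "nearly_free f d d1 d2 d3 \<longleftrightarrow>
     reduced_surface f d \<and> \<not> is_cone f \<and> 1 \<le> d1 \<and> d1 \<le> d2 \<and> d2 \<le> d3 \<and>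
     has_minimal_resolution (jacobian_ideal f)
       (vec (int d - 1) :: int^4)
       (vector [int d1 + (int d - 1), int d2 + (int d - 1),
                int d3 + (int d - 1), int d3 + (int d - 1)] :: int^4)
       (vec (int d3 + int d) :: int^1)"

definition coord_vec :: "S^4" where
  "coord_vec = vector [Var 1, Var 2, Var 3, Var 4]"

text \<open>
  The rows are \<open>r\<^sub>0, \<dots>, r\<^sub>4\<close> without \<open>r\<^sub>i\<close>, where \<open>r\<^sub>0\<close> is the vector of the coordinates,
  whatever the value of \<open>r\<close> at \<open>0\<close>.
\<close>

definition phi :: "(nat \<Rightarrow> S^4) \<Rightarrow> nat \<Rightarrow> S" where
  "phi r i = det (vector (map (r(0 := coord_vec)) (remove1 i [0..<5])) :: S^4^4)"

definition homogeneous_generators :: "(nat \<Rightarrow> S^4) \<Rightarrow> nat \<Rightarrow> nat \<Rightarrow> nat \<Rightarrow> bool" where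
  "homogeneous_generators r d1 d2 d3 \<longleftrightarrow>
     homogeneous_vec (int d1) (r 1) \<and> homogeneous_vec (int d2) (r 2) \<and>
     homogeneous_vec (int d3) (r 3) \<and> homogeneous_vec (int d3) (r 4)"

definition homogeneous_relation :: "(nat \<Rightarrow> S) \<Rightarrow> nat \<Rightarrow> nat \<Rightarrow> nat \<Rightarrow> bool" where
  "homogeneous_relation a d1 d2 d3 \<longleftrightarrow>
     homogeneous (int d3 - int d1 + 1) (a 1) \<and> homogeneous (int d3 - int d2 + 1) (a 2) \<and>
     homogeneous 1 (a 3) \<and> homogeneous 1 (a 4)"

end

theory Submission
  imports Defs "HOL-Computational_Algebra.Polynomial_Factorial" "HOL-Computational_Algebra.Field_as_Ring"
begin

text \<open>
  Write \<open>g\<close> for the gradient of \<open>f\<close>. Since \<open>f\<close> is squarefree, the entries of \<open>g\<close> have no common factor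
  (\<open>coprime_gradient\<close>). The generators \<open>r 1, \<dots>, r 4\<close> of the syzygies of \<open>g\<close> span a space of dimension three
  over the field of fractions, so one expects the relations among them to be governed by their maximal
  minors, as in the theorem of Hilbert and Burch.

  For a vector \<open>u\<close> let \<open>minor u r i\<close> be the determinant with rows \<open>u\<close> and the \<open>r j\<close> with \<open>j \<noteq> i\<close>. As a linear
  form in \<open>u\<close> it vanishes on the syzygies of \<open>g\<close>, hence is a multiple of the pairing with \<open>g\<close>: there are
  polynomials \<open>H i\<close> (\<open>quotient_minor\<close>) with \<open>minor u r i = H i * (u \<bullet> g)\<close> (\<open>minor_factor\<close>). When \<open>u\<close> is the vector of the
  coordinates, Euler's formula turns this into \<open>phi r i = H i * d * f\<close>, so everything comes down to
  showing that \<open>(-1) ^ i * H i\<close> generates the relations among the \<open>r i\<close>.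

  It is a relation by Cramer's rule. It is primitive: the Koszul syzygies \<open>g j * e k - g k * e j\<close> are
  combinations of the \<open>r i\<close>, so a common divisor of the \<open>H i\<close> divides their determinants, which are the
  cubes of the entries of \<open>g\<close>, and is therefore a unit (\<open>coprime_quotient_minors\<close>). Finally, any relation is
  proportional to it, and a vector proportional to a primitive one is a multiple of it
  (\<open>generates_relations_relation\<close>).

  The direct part follows because the given generator of the relations differs from this one by a unit,
  which is a constant. In the converse part the degree of \<open>H i\<close> is the degree of the minor minus \<open>d - 1\<close>,
  which under \<open>d1 + d2 + d3 = d\<close> is the degree required of \<open>a i\<close>; the gradient, the generators and the
  relation then form the minimal resolution. That its maps have entries of positive degree uses that \<open>f\<close>
  does not define a cone (\<open>is_cone_if_constant_syzygy\<close>).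

  The divisibility arguments need unique factorization, which is transported from iterated univariate
  polynomials.
\<close>

section \<open>Maps defined on monomials\<close>

lemma minus_single_plus_single:
  fixes m :: "'k \<Rightarrow>\<^sub>0 nat"
  assumes "Poly_Mapping.lookup m i \<noteq> 0"
  shows "m - Poly_Mapping.single i 1 + Poly_Mapping.single i 1 = m"
  using assms by (intro poly_mapping_eqI) (auto simp: lookup_add lookup_minus lookup_single when_def)

lemma poly_mapping_sum_singles:
  fixes p :: "'k \<Rightarrow>\<^sub>0 'c::comm_monoid_add"
  shows "p = (\<Sum>m\<in>Poly_Mapping.keys p. Poly_Mapping.single m (Poly_Mapping.lookup p m))"
  by (rule poly_mapping_eqI)
    (simp add: lookup_sum lookup_single when_def in_keys_iff if_distrib cong: if_cong)

lemma poly_mapping_add_induct [case_names single add]: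
  fixes p :: "'k \<Rightarrow>\<^sub>0 'c::comm_monoid_add"
  assumes "\<And>m c. P (Poly_Mapping.single m c)" and "\<And>p q. P p \<Longrightarrow> P q \<Longrightarrow> P (p + q)"
  shows "P p"
proof -
  have "P (\<Sum>m\<in>A. Poly_Mapping.single m (Poly_Mapping.lookup p m))" if "finite A" for A
    using that
  proof induction
    case empty
    show ?case using assms(1)[of undefined 0] by simp
  next
    case (insert x F)
    then show ?case using assms by simp
  qed
  from this[OF finite_keys, of p] show ?thesis
    using poly_mapping_sum_singles[of p] by simp
qed

text \<open>
  Substitution, partial differentiation, the isomorphism with iterated univariate polynomials and the
  grading are all given by their values \<open>h m c\<close> on single terms; one construction yields the additivity
  of all of them, and multiplicativity of those whose values on terms multiply.
\<close>

definition additive_ext :: "('k \<Rightarrow> 'c \<Rightarrow> 'a) \<Rightarrow> ('k \<Rightarrow>\<^sub>0 'c::comm_monoid_add) \<Rightarrow> 'a::comm_monoid_add" where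
  "additive_ext h p = (\<Sum>m\<in>Poly_Mapping.keys p. h m (Poly_Mapping.lookup p m))"

lemma additive_ext_superset:
  assumes "\<And>m. h m 0 = 0" "finite A" "Poly_Mapping.keys p \<subseteq> A"
  shows "additive_ext h p = (\<Sum>m\<in>A. h m (Poly_Mapping.lookup p m))"
  unfolding additive_ext_def using assms
  by (intro sum.mono_neutral_left) (auto simp: in_keys_iff)

lemma additive_ext_single:
  assumes "\<And>m. h m 0 = 0"
  shows "additive_ext h (Poly_Mapping.single m c) = h m c"
  using assms by (subst additive_ext_superset[of h "{m}"]) auto

lemma additive_ext_add:
  assumes "\<And>m. h m 0 = 0" "\<And>m a b. h m (a + b) = h m a + h m b"
  shows "additive_ext h (p + q) = additive_ext h p + additive_ext h q"
proof -
  let ?A = "Poly_Mapping.keys p \<union> Poly_Mapping.keys q"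
  have "Poly_Mapping.keys (p + q) \<subseteq> ?A" by (rule keys_add)
  then show ?thesis
    by (simp add: additive_ext_superset[where h = h and A = ?A] lookup_add assms sum.distrib)
qed

lemma additive_ext_mult:
  fixes h :: "'k::comm_monoid_add \<Rightarrow> 'c::comm_semiring_0 \<Rightarrow> 'a::comm_semiring_0"
  assumes "\<And>m. h m 0 = 0" "\<And>m a b. h m (a + b) = h m a + h m b"
    and "\<And>m n a b. h (m + n) (a * b) = h m a * h n b"
  shows "additive_ext h (p * q) = additive_ext h p * additive_ext h q"
proof (induction p rule: poly_mapping_add_induct)
  case (single m c)
  show ?case
    by (induction q rule: poly_mapping_add_induct)
      (simp_all add: mult_single additive_ext_single additive_ext_add assms distrib_left)
next
  case (add p p')
  then show ?case by (simp add: distrib_right additive_ext_add assms)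
qed

locale ring_hom =
  fixes h :: "'a::comm_ring_1 \<Rightarrow> 'b::comm_ring_1"
  assumes add: "h (x + y) = h x + h y" and mult: "h (x * y) = h x * h y" and one: "h 1 = 1"
begin

lemma zero: "h 0 = 0"
  using add[of 0 0] by simp

lemma sum: "h (sum g A) = (\<Sum>x\<in>A. h (g x))"
  by (induction A rule: infinite_finite_induct) (simp_all add: zero add)

lemma dvd: "x dvd y \<Longrightarrow> h x dvd h y"
  by (auto simp: dvd_def mult)

end

lemma ring_hom_additive_ext:
  fixes h :: "'k::comm_monoid_add \<Rightarrow> 'c::comm_ring_1 \<Rightarrow> 'a::comm_ring_1"
  assumes "\<And>m. h m 0 = 0" "\<And>m a b. h m (a + b) = h m a + h m b"
    and "\<And>m n a b. h (m + n) (a * b) = h m a * h n b" and "h 0 1 = 1"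
  shows "ring_hom (additive_ext h)"
  by unfold_locales
    (use additive_ext_add[of h] additive_ext_mult[of h] additive_ext_single[of h 0 1] assms in \<open>simp_all\<close>)

section \<open>Substitution and partial derivatives\<close>

lemma Const_0 [simp]: "Const 0 = 0" by (simp add: Const_def)
lemma Const_1 [simp]: "Const 1 = 1" by (simp add: Const_def)
lemma Const_add: "Const (a + b) = Const a + Const b" by (simp add: Const_def single_add)
lemma Const_mult: "Const (a * b) = Const a * Const b" by (simp add: Const_def mult_single)
lemma Const_of_nat: "Const (of_nat n) = of_nat n" by (simp add: Const_def)
lemma Const_eq_0_iff [simp]: "Const c = 0 \<longleftrightarrow> c = 0"
  by (metis Const_def inj_single injD single_zero)

lemma Const_dvd_1: "c \<noteq> 0 \<Longrightarrow> Const c dvd 1"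
  by (rule dvdI[of _ _ "Const (inverse c)"]) (simp flip: Const_mult)

lemma Var_power: "Var i ^ k = Poly_Mapping.single (Poly_Mapping.single i k) 1"
  by (induction k) (simp_all add: Var_def mult_single flip: single_add)

lemma prod_single:
  "(\<Prod>i\<in>A. Poly_Mapping.single (g i) (1::'c::comm_semiring_1)) = Poly_Mapping.single (\<Sum>i\<in>A. g i) 1"
  by (induction A rule: infinite_finite_induct) (simp_all add: mult_single)

lemma single_eq_monomial:
  "Poly_Mapping.single m c = Const c * (\<Prod>i\<in>UNIV. Var i ^ Poly_Mapping.lookup m i)"
proof -
  have "(\<Sum>i\<in>UNIV. Poly_Mapping.single i (Poly_Mapping.lookup m i)) = m"
    by (rule poly_mapping_eqI) (simp add: lookup_sum lookup_single when_def)
  then show ?thesis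
    by (simp add: Var_power prod_single Const_def mult_single)
qed

lemma S_induct [case_names Const Var add mult]:
  assumes C: "\<And>c. P (Const c)" and V: "\<And>i. P (Var i)"
    and A: "\<And>p q. P p \<Longrightarrow> P q \<Longrightarrow> P (p + q)" and M: "\<And>p q. P p \<Longrightarrow> P q \<Longrightarrow> P (p * q)"
  shows "P p"
proof (induction p rule: poly_mapping_add_induct)
  case (single m c)
  have 1: "P 1" using C[of 1] by simp
  have "P (Var i ^ k)" for i k by (induction k) (auto intro: 1 M V)
  then have "P (\<Prod>i\<in>B. Var i ^ Poly_Mapping.lookup m i)" for B
    by (induction B rule: infinite_finite_induct) (auto intro: 1 M)
  then show ?case by (simp add: single_eq_monomial C M)
qed (rule A)

lemma subst_eq: "subst \<sigma> = additive_ext (\<lambda>m c. Const c * (\<Prod>i\<in>UNIV. \<sigma> i ^ Poly_Mapping.lookup m i))"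
  by (simp add: fun_eq_iff subst_def additive_ext_def)

interpretation subst: ring_hom "subst \<sigma>" for \<sigma>
  unfolding subst_eq
  by (rule ring_hom_additive_ext)
    (simp_all add: Const_add Const_mult lookup_add power_add prod.distrib algebra_simps)

lemma subst_Const: "subst \<sigma> (Const c) = Const c"
  unfolding subst_eq Const_def by (subst additive_ext_single) (simp_all flip: Const_def)

lemma subst_Var: "subst \<sigma> (Var j) = \<sigma> j"
proof -
  have "(\<Prod>i\<in>UNIV. \<sigma> i ^ Poly_Mapping.lookup (Poly_Mapping.single j 1) i) = \<sigma> j"
    by (subst prod.remove[of _ j]) (simp_all add: lookup_single when_def)
  then show ?thesis
    unfolding subst_eq Var_def by (subst additive_ext_single) simp_all
qed

lemma pdiff_eq: "pdiff i = additive_ext (\<lambda>m c. Poly_Mapping.single (m - Poly_Mapping.single i 1)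
       (of_nat (Poly_Mapping.lookup m i) * c))"
  by (simp add: fun_eq_iff pdiff_def additive_ext_def)

lemma pdiff_single: "pdiff i (Poly_Mapping.single m c) =
  Poly_Mapping.single (m - Poly_Mapping.single i 1) (of_nat (Poly_Mapping.lookup m i) * c)"
  unfolding pdiff_eq by (rule additive_ext_single) simp

lemma pdiff_add: "pdiff i (p + q) = pdiff i p + pdiff i q"
  unfolding pdiff_eq by (rule additive_ext_add) (simp_all add: algebra_simps single_add)

lemma pdiff_Const [simp]: "pdiff i (Const c) = 0"
  by (simp add: Const_def pdiff_single)

lemma pdiff_Var: "pdiff i (Var j) = (if i = j then 1 else 0)"
  by (auto simp: Var_def pdiff_single lookup_single when_def)

lemma pdiff_mult: "pdiff i (p * q) = pdiff i p * q + p * pdiff i q"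
proof (induction p rule: poly_mapping_add_induct)
  case (single m a)
  show ?case
  proof (induction q rule: poly_mapping_add_induct)
    case (single n b)
    have shift: "Poly_Mapping.single (k - Poly_Mapping.single i 1 + l)
        (of_nat (Poly_Mapping.lookup k i) * c) =
      Poly_Mapping.single (k + l - Poly_Mapping.single i 1) (of_nat (Poly_Mapping.lookup k i) * c)"
      for k l :: "4 \<Rightarrow>\<^sub>0 nat" and c :: complex
    proof (cases "Poly_Mapping.lookup k i = 0")
      case False
      then have "k - Poly_Mapping.single i 1 + l = k + l - Poly_Mapping.single i 1"
        by (intro poly_mapping_eqI) (auto simp: lookup_add lookup_minus lookup_single when_def)
      then show ?thesis by simp
    qed simp
    show ?case
      using shift[of m n "a * b"] shift[of n m "a * b"]
      by (simp add: mult_single pdiff_single lookup_add distrib_right distrib_left single_add ac_simps)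
  qed (simp add: pdiff_add algebra_simps)
qed (simp add: pdiff_add algebra_simps)

text \<open>
  Shifting the exponent up on the right avoids the truncated subtraction in the definition of
  \<open>pdiff\<close>.
\<close>

lemma lookup_pdiff:
  "Poly_Mapping.lookup (pdiff i p) m =
   of_nat (Suc (Poly_Mapping.lookup m i)) * Poly_Mapping.lookup p (m + Poly_Mapping.single i 1)"
proof (induction p rule: poly_mapping_add_induct)
  case (single n c)
  show ?case
  proof (cases "n = m + Poly_Mapping.single i 1")
    case True
    then show ?thesis
      by (simp add: pdiff_single lookup_add)
  next
    case False
    have "Poly_Mapping.lookup n i = 0" if "n - Poly_Mapping.single i 1 = m"
    proof (rule ccontr)
      assume "Poly_Mapping.lookup n i \<noteq> 0"
      from minus_single_plus_single[OF this] that False show False by simp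
    qed
    with False show ?thesis
      by (auto simp: pdiff_single lookup_single when_def)
  qed
qed (simp add: pdiff_add lookup_add algebra_simps)

lemma pdiff_eq_0_iff: "pdiff i p = 0 \<longleftrightarrow> (\<forall>m\<in>Poly_Mapping.keys p. Poly_Mapping.lookup m i = 0)"
proof
  assume eq: "pdiff i p = 0"
  show "\<forall>m\<in>Poly_Mapping.keys p. Poly_Mapping.lookup m i = 0"
  proof (intro ballI, rule ccontr)
    fix m assume m: "m \<in> Poly_Mapping.keys p" "Poly_Mapping.lookup m i \<noteq> 0"
    have "Poly_Mapping.lookup p m = 0"
      using lookup_pdiff[of i p "m - Poly_Mapping.single i 1"] eq minus_single_plus_single[OF m(2)]
      by (simp del: of_nat_Suc)
    with m show False by (simp add: in_keys_iff)
  qed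
next
  assume "\<forall>m\<in>Poly_Mapping.keys p. Poly_Mapping.lookup m i = 0"
  then show "pdiff i p = 0"
    by (simp add: pdiff_def)
qed

lemma pdiff_sum: "pdiff i (sum g A) = (\<Sum>x\<in>A. pdiff i (g x))"
  by (induction A rule: infinite_finite_induct) (use pdiff_Const[of i 0] in \<open>simp_all add: pdiff_add\<close>)

text \<open>
  The chain rule. Both sides are derivations along the homomorphism \<open>subst \<sigma>\<close>, so it is enough to
  compare them on constants and variables.
\<close>

lemma pdiff_subst: "pdiff i (subst \<sigma> p) = (\<Sum>k\<in>UNIV. subst \<sigma> (pdiff k p) * pdiff i (\<sigma> k))"
proof (induction p rule: S_induct)
  case (Const c)
  show ?case by (simp add: subst_Const subst.zero)
next
  case (Var j)
  have "(\<Sum>k\<in>UNIV. subst \<sigma> (pdiff k (Var j)) * pdiff i (\<sigma> k)) =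
        (\<Sum>k\<in>UNIV. if k = j then pdiff i (\<sigma> k) else 0)"
    by (intro sum.cong) (simp_all add: pdiff_Var subst.zero subst.one)
  then show ?case by (simp add: subst_Var)
next
  case (add p q)
  then show ?case by (simp add: pdiff_add subst.add sum.distrib algebra_simps)
next
  case (mult p q)
  then show ?case
    by (simp add: pdiff_mult subst.add subst.mult sum.distrib sum_distrib_left sum_distrib_right algebra_simps)
qed

lemma single_shift:
  assumes "Poly_Mapping.lookup m i \<noteq> 0"
  shows "Poly_Mapping.single m c = Var i * Poly_Mapping.single (m - Poly_Mapping.single i 1) c"
proof -
  have "Poly_Mapping.single i 1 + (m - Poly_Mapping.single i 1) = m"
    using minus_single_plus_single[OF assms] by (simp add: add.commute)
  then show ?thesis by (simp add: Var_def mult_single)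
qed

lemma Var_mult_pdiff_single:
  "Var i * pdiff i (Poly_Mapping.single m c) = of_nat (Poly_Mapping.lookup m i) * Poly_Mapping.single m c"
proof (cases "Poly_Mapping.lookup m i = 0")
  case True
  then show ?thesis by (simp add: pdiff_single)
next
  case False
  show ?thesis
    unfolding pdiff_single
    using single_shift[OF False, of "of_nat (Poly_Mapping.lookup m i) * c"]
      mult_single[of 0 "of_nat (Poly_Mapping.lookup m i)" m c] by simp
qed

text \<open>
  The operator \<open>\<Sum>\<^sub>i x\<^sub>i \<partial>/\<partial>x\<^sub>i\<close> multiplies each monomial by its total degree.
\<close>

lemma euler_formula:
  assumes "homogeneous (int d) p"
  shows "(\<Sum>i\<in>UNIV. Var i * pdiff i p) = of_nat d * p"
proof -
  have "(\<Sum>i\<in>UNIV. Var i * pdiff i p) =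
      (\<Sum>m\<in>Poly_Mapping.keys p. \<Sum>i\<in>UNIV.
         Var i * pdiff i (Poly_Mapping.single m (Poly_Mapping.lookup p m)))"
    by (subst (1) poly_mapping_sum_singles[of p]) (simp add: pdiff_sum sum_distrib_left sum.swap[of _ UNIV])
  also have "\<dots> = (\<Sum>m\<in>Poly_Mapping.keys p. of_nat (mdeg m) * Poly_Mapping.single m (Poly_Mapping.lookup p m))"
    by (simp add: Var_mult_pdiff_single mdeg_def flip: sum_distrib_right)
  also have "\<dots> = (\<Sum>m\<in>Poly_Mapping.keys p. of_nat d * Poly_Mapping.single m (Poly_Mapping.lookup p m))"
    using assms by (intro sum.cong) (auto simp: homogeneous_def)
  also have "\<dots> = of_nat d * p"
    by (subst (3) poly_mapping_sum_singles[of p]) (simp add: sum_distrib_left)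
  finally show ?thesis .
qed

section \<open>Factoriality of the polynomial ring\<close>

text \<open>
  Unique factorization is inherited from iterated univariate polynomials, for which it follows
  from Gauss's lemma. The variable \<open>1\<close> becomes the outermost indeterminate and the variable \<open>4\<close> the
  innermost one.
\<close>

definition to_poly4 :: "S \<Rightarrow> complex poly poly poly poly" where
  "to_poly4 = additive_ext (\<lambda>m c. monom (monom (monom (monom c
     (Poly_Mapping.lookup m 4)) (Poly_Mapping.lookup m 3)) (Poly_Mapping.lookup m 2)) (Poly_Mapping.lookup m 1))"

interpretation to_poly4: ring_hom to_poly4
  unfolding to_poly4_def
  by (rule ring_hom_additive_ext) (simp_all add: add_monom mult_monom lookup_add one_pCons monom_0)

lemma to_poly4_single: "to_poly4 (Poly_Mapping.single m c) = monom (monom (monom (monom c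
     (Poly_Mapping.lookup m 4)) (Poly_Mapping.lookup m 3)) (Poly_Mapping.lookup m 2)) (Poly_Mapping.lookup m 1)"
  unfolding to_poly4_def by (rule additive_ext_single) simp

lemma coeff_to_poly4:
  "coeff (coeff (coeff (coeff (to_poly4 p)
     (Poly_Mapping.lookup m 1)) (Poly_Mapping.lookup m 2)) (Poly_Mapping.lookup m 3)) (Poly_Mapping.lookup m 4)
   = Poly_Mapping.lookup p m"
proof (induction p rule: poly_mapping_add_induct)
  case (single n c)
  have "n = m \<longleftrightarrow> (\<forall>i. Poly_Mapping.lookup n i = Poly_Mapping.lookup m i)"
    by (simp add: poly_mapping_eq_iff fun_eq_iff)
  then show ?case
    by (auto simp: to_poly4_single lookup_single when_def forall_4)
qed (simp add: to_poly4.add lookup_add)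

lemma inj_to_poly4: "inj to_poly4"
  by (intro injI poly_mapping_eqI) (metis coeff_to_poly4)

lemma to_poly4_Const: "to_poly4 (Const c) = [:[:[:[:c:]:]:]:]"
  by (simp add: Const_def to_poly4_single monom_0)

text \<open>
  A subring that contains the constants and the indeterminate contains all polynomials. Surjectivity
  of \<open>to_poly4\<close> follows by applying this to one indeterminate after the other, where \<open>\<iota>\<close> is the inclusion
  of the polynomials in the inner indeterminates.
\<close>

lemma poly_in_subring:
  fixes \<iota> :: "'a::comm_ring_1 poly \<Rightarrow> 'b::comm_ring_1"
  assumes "ring_hom \<iota>" "\<And>c. \<iota> [:c:] \<in> R" "\<iota> [:0, 1:] \<in> R"
    and "\<And>x y. x \<in> R \<Longrightarrow> y \<in> R \<Longrightarrow> x + y \<in> R" "\<And>x y. x \<in> R \<Longrightarrow> y \<in> R \<Longrightarrow> x * y \<in> R"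
  shows "\<iota> q \<in> R"
proof (induction q)
  case 0
  show ?case using assms(2)[of 0] by simp
next
  case (pCons a q)
  interpret ring_hom \<iota> by fact
  have "\<iota> (pCons a q) = \<iota> [:a:] + \<iota> [:0, 1:] * \<iota> q" by (simp flip: add mult)
  then show ?case using pCons.IH assms(2-5) by simp
qed

lemma surj_to_poly4: "surj to_poly4"
proof -
  let ?R = "range to_poly4"
  have A: "x + y \<in> ?R" and M: "x * y \<in> ?R" if "x \<in> ?R" "y \<in> ?R" for x y
    using that by (auto simp flip: to_poly4.add to_poly4.mult)
  have X: "to_poly4 (Var i) \<in> ?R" for i by simp
  have X1: "[:0, 1:] \<in> ?R" and X2: "[:[:0, 1:]:] \<in> ?R"
    and X3: "[:[:[:0, 1:]:]:] \<in> ?R" and X4: "[:[:[:[:0, 1:]:]:]:] \<in> ?R"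
    using X[of 1] X[of 2] X[of 3] X[of 4]
    by (simp_all add: Var_def to_poly4_single lookup_single when_def monom_0 monom_Suc one_pCons)
  have 1: "[:[:[:q:]:]:] \<in> ?R" for q
    by (rule poly_in_subring[of "\<lambda>q. [:[:[:q:]:]:]"])
      (use X4 rangeI[of to_poly4 "Const c" for c] in \<open>auto intro: A M simp: to_poly4_Const one_pCons ring_hom_def\<close>)
  have 2: "[:[:q:]:] \<in> ?R" for q
    by (rule poly_in_subring[of "\<lambda>q. [:[:q:]:]"])
      (use X3 1 in \<open>auto intro: A M simp: one_pCons ring_hom_def\<close>)
  have 3: "[:q:] \<in> ?R" for q
    by (rule poly_in_subring[of "\<lambda>q. [:q:]"])
      (use X2 2 in \<open>auto intro: A M simp: one_pCons ring_hom_def\<close>)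
  have "q \<in> ?R" for q
    by (rule poly_in_subring[of "\<lambda>q. q"])
      (use X1 3 in \<open>auto intro: A M simp: one_pCons ring_hom_def\<close>)
  then show ?thesis by blast
qed

lemma to_poly4_dvd_iff: "to_poly4 p dvd to_poly4 q \<longleftrightarrow> p dvd q"
proof
  assume "to_poly4 p dvd to_poly4 q"
  then obtain k where "to_poly4 q = to_poly4 (p * k)"
    using surj_to_poly4 unfolding dvd_def surj_def to_poly4.mult by metis
  then show "p dvd q" using inj_to_poly4 by (auto dest: injD)
qed (rule to_poly4.dvd)

lemma to_poly4_eq_iff: "to_poly4 p = to_poly4 q \<longleftrightarrow> p = q"
  using inj_to_poly4 by (auto dest: injD)

lemma to_poly4_eq_0_iff: "to_poly4 p = 0 \<longleftrightarrow> p = 0"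
  using to_poly4_eq_iff[of p 0] by (simp add: to_poly4.zero)

lemma to_poly4_dvd_1_iff: "to_poly4 p dvd 1 \<longleftrightarrow> p dvd 1"
  using to_poly4_dvd_iff[of p 1] by (simp add: to_poly4.one)

lemma to_poly4_prime_elem_iff: "prime_elem (to_poly4 p) \<longleftrightarrow> prime_elem p"
proof -
  have all: "(\<forall>x. P x) \<longleftrightarrow> (\<forall>q. P (to_poly4 q))" for P
    using surj_to_poly4 by (metis surjD)
  show ?thesis
    unfolding prime_elem_def all
    by (simp add: to_poly4_dvd_iff to_poly4_eq_0_iff to_poly4_dvd_1_iff flip: to_poly4.mult)
qed

text \<open>
  The existence of prime factorizations, in the form in which it is used: an element is zero, a unit,
  or a prime times a smaller element.
\<close>

lemma S_prime_induct [case_names zero unit factor]: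
  fixes x :: S
  assumes "P 0" "\<And>x. x dvd 1 \<Longrightarrow> P x" "\<And>p x. prime_elem p \<Longrightarrow> P x \<Longrightarrow> P (p * x)"
  shows "P x"
proof -
  have "\<forall>x. y = to_poly4 x \<longrightarrow> P x" for y
  proof (induction y rule: prime_divisors_induct)
    case zero
    show ?case using assms(1) to_poly4_eq_0_iff by (metis)
  next
    case (unit y)
    then show ?case using assms(2) by (auto simp: to_poly4_dvd_1_iff)
  next
    case (factor q y)
    obtain p z where "q = to_poly4 p" "y = to_poly4 z" using surj_to_poly4 by (metis surjD)
    moreover have "prime_elem q" using factor by blast
    ultimately show ?case
      using factor.IH assms(3) by (simp add: to_poly4_prime_elem_iff to_poly4_eq_iff flip: to_poly4.mult)
  qed
  then show ?thesis by blast
qed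

lemma S_prime_divisor_exists:
  fixes x :: S
  assumes "x \<noteq> 0" "\<not> x dvd 1"
  obtains p where "prime_elem p" "p dvd x"
proof -
  have "x = 0 \<or> x dvd 1 \<or> (\<exists>p. prime_elem p \<and> p dvd x)"
    by (induction x rule: S_prime_induct) auto
  with assms that show thesis by blast
qed

lemma S_unit_Const:
  fixes p :: S
  assumes "p dvd 1"
  obtains c where "c \<noteq> 0" "p = Const c"
proof -
  have "to_poly4 p dvd 1"
    using assms by (simp add: to_poly4_dvd_1_iff)
  then obtain c where c: "to_poly4 p = [:[:[:[:c:]:]:]:]" "c dvd 1"
    by (auto simp: is_unit_poly_iff)
  then have "p = Const c" by (simp add: to_poly4_eq_iff flip: to_poly4_Const)
  moreover have "c \<noteq> 0" using c(2) by auto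
  ultimately show thesis using that by blast
qed

text \<open>
  The common divisors of the whole family are units; this is weaker than pairwise coprimality.
\<close>

definition coprime_family :: "'i set \<Rightarrow> ('i \<Rightarrow> S) \<Rightarrow> bool" where
  "coprime_family I g \<longleftrightarrow> (\<forall>q. (\<forall>j\<in>I. q dvd g j) \<longrightarrow> q dvd 1)"

text \<open>
  In terms of greatest common divisors: \<open>x\<close> divides \<open>gcd\<^sub>j (v g\<^sub>j) = v\<close>. The induction removes one
  prime factor \<open>p\<close> of \<open>x\<close> at a time; as \<open>p\<close> fails to divide some \<open>g j\<close>, it divides \<open>v\<close>.
\<close>

lemma dvd_if_dvd_mult_coprime_family:
  assumes "x \<noteq> 0" "coprime_family I g" "\<And>j. j \<in> I \<Longrightarrow> x dvd v * g j"
  shows "x dvd v"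
  using assms(1,3)
proof (induction x arbitrary: v rule: S_prime_induct)
  case zero
  then show ?case by simp
next
  case (unit x)
  then show ?case by (meson dvd_trans one_dvd)
next
  case (factor p x)
  have p: "prime_elem p" "p \<noteq> 0" using factor.hyps by auto
  have "\<not> p dvd 1" using p by (auto simp: prime_elem_def)
  then obtain j where j: "j \<in> I" "\<not> p dvd g j"
    using assms(2) unfolding coprime_family_def by blast
  have "p dvd v * g j" using factor.prems(2)[OF j(1)] by (meson dvd_mult_left)
  then have "p dvd v" using p j by (simp add: prime_elem_dvd_mult_iff)
  then obtain v' where v': "v = p * v'" by (auto simp: dvd_def)
  have "x dvd v' * g j" if "j \<in> I" for j
    using factor.prems(2)[OF that] p(2) by (simp add: v' mult.assoc)
  moreover have "x \<noteq> 0" using factor.prems(1) by simp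
  ultimately have "x dvd v'" using factor.IH by blast
  then show ?case by (simp add: v')
qed

text \<open>
  A vector that is proportional to a coprime one over the field of fractions is a multiple of it over
  the ring, because the denominator of the factor would divide all \<open>g j\<close>. This is how division by the
  gradient, and by a primitive relation, stays inside the polynomial ring.
\<close>

lemma proportional_to_coprime_family:
  assumes cop: "coprime_family I g" and k: "k \<in> I" "g k \<noteq> 0"
    and eq: "\<And>j. j \<in> I \<Longrightarrow> v j * g k = v k * g j"
  shows "\<exists>h. \<forall>j\<in>I. v j = h * g j"
proof -
  have "g k dvd v k"
    by (rule dvd_if_dvd_mult_coprime_family[OF k(2) cop]) (simp flip: eq)
  then obtain h where "v k = g k * h" by (auto simp: dvd_def)
  then have "v j = h * g j" if "j \<in> I" for j
    using eq[OF that] k(2) by (simp add: algebra_simps)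
  then show ?thesis by blast
qed

lemma unit_if_dvd_powers:
  assumes "coprime_family I g" "k \<in> I" "g k \<noteq> 0" "\<And>j. j \<in> I \<Longrightarrow> q dvd g j ^ n"
  shows "q dvd 1"
proof (rule ccontr)
  assume nu: "\<not> q dvd 1"
  have "q \<noteq> 0" using assms(3) assms(4)[OF assms(2)] by auto
  then obtain p where p: "prime_elem p" "p dvd q" using nu S_prime_divisor_exists by blast
  have "p dvd g j" if "j \<in> I" for j
    using p assms(4)[OF that] by (meson dvd_trans prime_elem_dvd_power)
  then have "p dvd 1" using assms(1) unfolding coprime_family_def by blast
  with p show False by (auto simp: prime_elem_def)
qed

section \<open>Degrees\<close>

lemma mdeg_0 [simp]: "mdeg 0 = 0" by (simp add: mdeg_def)
lemma mdeg_add: "mdeg (m + n) = mdeg m + mdeg n" by (simp add: mdeg_def lookup_add sum.distrib)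
lemma mdeg_single [simp]: "mdeg (Poly_Mapping.single i k) = k"
  by (simp add: mdeg_def lookup_single when_def)

lemma homogeneous_0 [simp]: "homogeneous k 0" by (simp add: homogeneous_def)

lemma homogeneous_add: "homogeneous k p \<Longrightarrow> homogeneous k q \<Longrightarrow> homogeneous k (p + q)"
  using keys_add[of p q] by (auto simp: homogeneous_def)

lemma homogeneous_uminus: "homogeneous k p \<Longrightarrow> homogeneous k (- p)"
  by (simp add: homogeneous_def in_keys_iff lookup_uminus)

lemma homogeneous_diff: "homogeneous k p \<Longrightarrow> homogeneous k q \<Longrightarrow> homogeneous k (p - q)"
  using homogeneous_add[of k p "- q"] by (simp add: homogeneous_uminus)

lemma homogeneous_mult: "homogeneous k p \<Longrightarrow> homogeneous l q \<Longrightarrow> homogeneous (k + l) (p * q)"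
  using keys_mult[of p q] by (fastforce simp: homogeneous_def mdeg_add)

lemma homogeneous_Const: "homogeneous 0 (Const c)"
  by (simp add: homogeneous_def Const_def)

lemma homogeneous_pdiff: "homogeneous k p \<Longrightarrow> homogeneous (k - 1) (pdiff i p)"
  unfolding homogeneous_def
proof
  fix m assume p: "\<forall>m\<in>Poly_Mapping.keys p. int (mdeg m) = k" and m: "m \<in> Poly_Mapping.keys (pdiff i p)"
  then have "m + Poly_Mapping.single i 1 \<in> Poly_Mapping.keys p"
    by (auto simp: in_keys_iff lookup_pdiff)
  with p have "int (mdeg (m + Poly_Mapping.single i 1)) = k" by blast
  then show "int (mdeg m) = k - 1" by (simp add: mdeg_add)
qed

lemma homogeneous_0_imp_Const:
  assumes "homogeneous 0 p"
  obtains c where "p = Const c"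
proof -
  have "mdeg m = 0 \<Longrightarrow> m = 0" for m
    by (auto simp: mdeg_def poly_mapping_eq_iff fun_eq_iff)
  then have "Poly_Mapping.keys p \<subseteq> {0}" using assms by (auto simp: homogeneous_def)
  then have "p = Const (Poly_Mapping.lookup p 0)"
    by (intro poly_mapping_eqI) (auto simp: Const_def lookup_single when_def in_keys_iff)
  then show thesis using that by blast
qed

text \<open>
  The homomorphism \<open>p(x) \<mapsto> p(t x)\<close> to polynomials in a new indeterminate \<open>t\<close>. The coefficient of \<open>t\<^sup>n\<close> is
  the homogeneous component of degree \<open>n\<close>, so homogeneity and total degree become statements about
  univariate polynomials over a domain.
\<close>

definition grade :: "S \<Rightarrow> S poly" where
  "grade = additive_ext (\<lambda>m c. monom (Poly_Mapping.single m c) (mdeg m))"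

interpretation grade: ring_hom grade
  unfolding grade_def
  by (rule ring_hom_additive_ext) (simp_all add: add_monom mult_monom mdeg_add single_add mult_single one_pCons)

lemma lookup_coeff_grade:
  "Poly_Mapping.lookup (coeff (grade p) n) m = (if mdeg m = n then Poly_Mapping.lookup p m else 0)"
proof (induction p rule: poly_mapping_add_induct)
  case (single k c)
  have "grade (Poly_Mapping.single k c) = monom (Poly_Mapping.single k c) (mdeg k)"
    unfolding grade_def by (rule additive_ext_single) simp
  then show ?case by (auto simp: lookup_single when_def)
qed (simp add: grade.add lookup_add)

lemma grade_eq_0_iff: "grade p = 0 \<longleftrightarrow> p = 0"
proof
  assume "grade p = 0"
  then show "p = 0"
    using lookup_coeff_grade[of p] by (intro poly_mapping_eqI) (metis coeff_0 lookup_zero)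
qed (simp add: grade.zero)

lemma homogeneous_iff_grade: "homogeneous (int k) p \<longleftrightarrow> grade p = monom p k"
proof
  assume "homogeneous (int k) p"
  then show "grade p = monom p k"
    by (intro poly_eqI poly_mapping_eqI) (auto simp: lookup_coeff_grade homogeneous_def in_keys_iff)
next
  assume "grade p = monom p k"
  then have "Poly_Mapping.lookup p m = 0" if "mdeg m \<noteq> k" for m
    using lookup_coeff_grade[of p "mdeg m" m] that by simp
  then show "homogeneous (int k) p"
    by (auto simp: homogeneous_def in_keys_iff)
qed

lemma homogeneous_nonzero_degree:
  assumes "homogeneous k p" "p \<noteq> 0"
  obtains n where "k = int n"
proof -
  obtain m where "m \<in> Poly_Mapping.keys p" using assms(2) by fastforce
  then have "k = int (mdeg m)" using assms(1) by (simp add: homogeneous_def)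
  then show thesis by (rule that)
qed

text \<open>
  Comparison of the coefficients of \<open>grade p * monom g e = monom (p * g) k\<close> leaves at most one nonzero
  component of \<open>p\<close>.
\<close>

lemma homogeneous_cancel_right:
  assumes pg: "homogeneous k (p * g)" and g: "homogeneous e g" "g \<noteq> 0"
  shows "homogeneous (k - e) p"
proof (cases "p = 0")
  case False
  have "p * g \<noteq> 0" using False g(2) by simp
  with pg obtain k' where k: "k = int k'" by (rule homogeneous_nonzero_degree)
  obtain e' where e: "e = int e'" using g by (rule homogeneous_nonzero_degree)
  have "monom g e' * grade p = monom (p * g) k'"
    using pg g(1) by (simp add: k e homogeneous_iff_grade grade.mult mult.commute)
  then have "coeff (monom g e' * grade p) (n + e') = coeff (monom (p * g) k') (n + e')" for n
    by simp
  then have coeff: "g * coeff (grade p) n = (if k' = n + e' then p * g else 0)" for n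
    by (simp add: coeff_monom_mult)
  have *: "coeff (grade p) n = 0" if "k' \<noteq> n + e'" for n
    using coeff[of n] that g(2) by simp
  show ?thesis
    unfolding homogeneous_def
  proof
    fix m assume "m \<in> Poly_Mapping.keys p"
    then have "coeff (grade p) (mdeg m) \<noteq> 0"
      using lookup_coeff_grade[of p "mdeg m" m] by (auto simp: in_keys_iff)
    then show "int (mdeg m) = k - e" using * k e by force
  qed
qed simp

text \<open>
  A nonzero derivative has smaller total degree than \<open>p\<close>, hence is not a multiple of \<open>p\<close>.
\<close>

lemma dvd_pdiff_imp_0:
  assumes "p dvd pdiff i p"
  shows "pdiff i p = 0"
proof (rule ccontr)
  assume nz: "pdiff i p \<noteq> 0"
  define n where "n = degree (grade (pdiff i p))"
  have "coeff (grade (pdiff i p)) n \<noteq> 0"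
    using nz by (simp add: n_def grade_eq_0_iff)
  then obtain m where "Poly_Mapping.lookup (coeff (grade (pdiff i p)) n) m \<noteq> 0"
    by (metis poly_mapping_eqI lookup_zero)
  then have m: "mdeg m = n" "Poly_Mapping.lookup (pdiff i p) m \<noteq> 0"
    by (auto simp: lookup_coeff_grade split: if_splits)
  have "coeff (grade p) (Suc n) \<noteq> 0"
    using m lookup_coeff_grade[of p "Suc n" "m + Poly_Mapping.single i 1"]
    by (auto simp: lookup_pdiff mdeg_add)
  then have "Suc n \<le> degree (grade p)" by (rule le_degree)
  moreover have "degree (grade p) \<le> n"
    unfolding n_def using assms nz by (intro dvd_imp_degree_le grade.dvd) (simp_all add: grade_eq_0_iff)
  ultimately show False by simp
qed

lemma all_pdiff_0_imp_Const:
  assumes "\<And>i. pdiff i p = 0"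
  obtains c where "p = Const c"
proof -
  have "homogeneous 0 p"
    using assms by (auto simp: homogeneous_def pdiff_eq_0_iff mdeg_def)
  then show thesis using that homogeneous_0_imp_Const by blast
qed

section \<open>Gradients of reduced surfaces and cones\<close>

lemma of_nat_dvd_S: "d > 0 \<Longrightarrow> (of_nat d :: S) dvd 1"
  using Const_dvd_1[of "of_nat d"] by (simp add: Const_of_nat)

text \<open>
  A common prime divisor \<open>p\<close> of the partial derivatives divides \<open>f = p g\<close> by Euler's formula, and then
  \<open>pdiff j p * g\<close> by the product rule. Since \<open>f\<close> is squarefree, \<open>p\<close> does not divide \<open>g\<close>, so it divides
  its own derivatives. For degree reasons these vanish and \<open>p\<close> is constant.
\<close>

lemma coprime_gradient:
  assumes "reduced_surface f d"
  shows "coprime_family UNIV (\<lambda>j. pdiff j f)"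
  unfolding coprime_family_def
proof (intro allI impI, rule ccontr)
  fix q assume q: "\<forall>j\<in>UNIV. q dvd pdiff j f" and nu: "\<not> q dvd 1"
  have f: "f \<noteq> 0" "d > 0" "homogeneous (int d) f" "squarefree f"
    using assms by (auto simp: reduced_surface_def)
  have "x dvd f" if "\<And>j. x dvd pdiff j f" for x
  proof -
    have "x dvd (\<Sum>j\<in>UNIV. Var j * pdiff j f)" using that by (intro dvd_sum dvd_mult)
    then have "x dvd of_nat d * f" by (simp add: euler_formula[OF f(3)])
    moreover obtain u :: S where "1 = of_nat d * u" using of_nat_dvd_S[OF f(2)] by (rule dvdE)
    then have "f = of_nat d * f * u" by (metis mult.commute mult.left_commute mult_1)
    ultimately show ?thesis by (metis dvd_mult2)
  qed
  note dvd_f = this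
  have "q \<noteq> 0" using dvd_f[of q] q f(1) by auto
  then obtain p where p: "prime_elem p" "p dvd q" using nu S_prime_divisor_exists by blast
  have dvd: "p dvd pdiff j f" for j using p(2) q by (blast intro: dvd_trans)
  obtain g where g: "f = p * g" using dvd_f[OF dvd] by (auto simp: dvd_def)
  have "\<not> p dvd 1" using p by (auto simp: prime_elem_def)
  then have ng: "\<not> p dvd g"
    using squarefreeD[OF f(4), of p] by (auto simp: g power2_eq_square)
  have "pdiff j p = 0" for j
  proof -
    have "p dvd pdiff j p * g"
      using dvd[of j] by (simp add: g pdiff_mult dvd_add_left_iff)
    then show ?thesis
      using p ng by (auto simp: prime_elem_dvd_mult_iff intro: dvd_pdiff_imp_0)
  qed
  then obtain c where "p = Const c" by (rule all_pdiff_0_imp_Const)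
  with \<open>\<not> p dvd 1\<close> p(1) show False by (cases "c = 0") (auto simp: Const_dvd_1)
qed

lemma gradient_nonzero:
  assumes "reduced_surface f d"
  obtains j where "pdiff j f \<noteq> 0"
proof -
  have "of_nat d * f \<noteq> 0" using assms by (auto simp: reduced_surface_def)
  then have "(\<Sum>j\<in>UNIV. Var j * pdiff j f) \<noteq> 0"
    using assms euler_formula[of d f] by (simp add: reduced_surface_def)
  then show thesis using that by (metis (no_types, lifting) mult_zero_right sum.neutral)
qed

lemma homogeneous_in_irrelevant_ideal:
  assumes "homogeneous k p" "k \<ge> 1"
  shows "p \<in> irrelevant_ideal"
proof -
  note span_base = module.span_base[OF module_S] and span_scale = module.span_scale[OF module_S]
  have "Poly_Mapping.single m c \<in> irrelevant_ideal" if m: "mdeg m \<noteq> 0" for m c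
  proof -
    have "\<exists>i. Poly_Mapping.lookup m i \<noteq> 0"
      using m unfolding mdeg_def by (rule contrapos_np) simp
    then obtain i where "Poly_Mapping.lookup m i \<noteq> 0" ..
    from single_shift[OF this, of c]
    have "Poly_Mapping.single m c = Poly_Mapping.single (m - Poly_Mapping.single i 1) c * Var i"
      by (simp only: mult.commute)
    then show ?thesis
      unfolding irrelevant_ideal_def by (simp only: span_scale span_base rangeI)
  qed
  then have "(\<Sum>m\<in>Poly_Mapping.keys p. Poly_Mapping.single m (Poly_Mapping.lookup p m)) \<in> irrelevant_ideal"
    unfolding irrelevant_ideal_def
    using assms by (intro module.span_sum[OF module_S]) (force simp: homogeneous_def)
  then show ?thesis
    by (simp only: poly_mapping_sum_singles[symmetric])
qed

text \<open>
  A constant syzygy \<open>c\<close> of the gradient says that the derivative of \<open>f\<close> in the direction \<open>c\<close> vanishes. A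
  linear change that moves a coordinate axis to \<open>c\<close> then makes \<open>f\<close> independent of that coordinate.
\<close>

lemma is_cone_if_constant_syzygy:
  assumes c: "c \<noteq> 0" and syz: "(\<Sum>k\<in>UNIV. Const (c $ k) * pdiff k f) = 0"
  shows "is_cone f"
proof -
  obtain i where i: "c $ i \<noteq> 0" using c by (auto simp: vec_eq_iff)
  \<comment> \<open>the identity matrix with column \<open>i\<close> replaced by \<open>c\<close>; it is invertible because \<open>c $ i\<close> is not zero\<close>
  define A :: "complex^4^4" where "A = (\<chi> k j. if j = i then c $ k else if k = j then 1 else 0)"
  have Av: "(A *v x) $ k = (if k = i then c $ i * x $ i else c $ k * x $ i + x $ k)" for x k
  proof -
    have "(A *v x) $ k = (\<Sum>j\<in>UNIV. (if j = i then c $ k * x $ i else 0) + (if j = k \<and> k \<noteq> i then x $ k else 0))"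
      unfolding A_def matrix_vector_mult_def by (auto intro!: sum.cong)
    also have "\<dots> = c $ k * x $ i + (if k \<noteq> i then x $ k else 0)"
      by (cases "k = i") (simp_all add: sum.distrib)
    finally show ?thesis by auto
  qed
  have "x = 0" if "A *v x = 0" for x
  proof -
    have "(A *v x) $ k = 0" for k using that by simp
    note eq = this[unfolded Av]
    have "x $ i = 0" using eq[of i] i by simp
    then have "x $ k = 0" for k using eq[of k] by (cases "k = i") auto
    then show ?thesis by (simp add: vec_eq_iff)
  qed
  then have "invertible A"
    by (auto simp: invertible_left_inverse matrix_left_invertible_ker)
  moreover have "pdiff i (linear_change A f) = 0"
  proof -
    define \<sigma> where "\<sigma> = (\<lambda>k. \<Sum>j\<in>UNIV. Const (A $ k $ j) * Var j)"
    have "pdiff i (\<sigma> k) = Const (c $ k)" for k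
    proof -
      have "pdiff i (\<sigma> k) = (\<Sum>j\<in>UNIV. if j = i then Const (A $ k $ j) else 0)"
        unfolding \<sigma>_def pdiff_sum by (intro sum.cong) (simp_all add: pdiff_mult pdiff_Var)
      then show ?thesis by (simp add: A_def)
    qed
    then have "pdiff i (subst \<sigma> f) = subst \<sigma> (\<Sum>k\<in>UNIV. Const (c $ k) * pdiff k f)"
      by (simp add: pdiff_subst subst.sum subst.mult subst_Const mult.commute)
    also have "\<dots> = 0" by (simp only: syz subst.zero)
    finally show ?thesis by (simp add: linear_change_def \<sigma>_def)
  qed
  ultimately show ?thesis
    unfolding is_cone_def pdiff_eq_0_iff by blast
qed

section \<open>Determinants with four rows\<close>

lemma det_4:
  "det (A::'a::comm_ring_1^4^4) =
    A$1$1 * (A$2$2 * (A$3$3 * A$4$4 - A$3$4 * A$4$3) - A$2$3 * (A$3$2 * A$4$4 - A$3$4 * A$4$2)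
           + A$2$4 * (A$3$2 * A$4$3 - A$3$3 * A$4$2))
  - A$1$2 * (A$2$1 * (A$3$3 * A$4$4 - A$3$4 * A$4$3) - A$2$3 * (A$3$1 * A$4$4 - A$3$4 * A$4$1)
           + A$2$4 * (A$3$1 * A$4$3 - A$3$3 * A$4$1))
  + A$1$3 * (A$2$1 * (A$3$2 * A$4$4 - A$3$4 * A$4$2) - A$2$2 * (A$3$1 * A$4$4 - A$3$4 * A$4$1)
           + A$2$4 * (A$3$1 * A$4$2 - A$3$2 * A$4$1))
  - A$1$4 * (A$2$1 * (A$3$2 * A$4$3 - A$3$3 * A$4$2) - A$2$2 * (A$3$1 * A$4$3 - A$3$3 * A$4$1)
           + A$2$3 * (A$3$1 * A$4$2 - A$3$2 * A$4$1))"
proof -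
  have f1: "finite {2::4, 3, 4}" "1 \<notin> {2::4, 3, 4}" by auto
  have f2: "finite {3::4, 4}" "2 \<notin> {3::4, 4}" by auto
  have f3: "finite {4::4}" "3 \<notin> {4::4}" by auto
  show ?thesis
    unfolding det_def UNIV_4
    unfolding sum_over_permutations_insert[OF f1]
    unfolding sum_over_permutations_insert[OF f2]
    unfolding sum_over_permutations_insert[OF f3]
    unfolding permutes_sing
    by (simp add: sign_swap_id permutation_swap_id permutation_compose sign_compose sign_id swap_id_eq algebra_simps)
qed

abbreviation det4 :: "S^4 \<Rightarrow> S^4 \<Rightarrow> S^4 \<Rightarrow> S^4 \<Rightarrow> S" where
  "det4 u v s t \<equiv> det (vector [u, v, s, t] :: S^4^4)"

lemmas det4_expand = det_4 vector_4

text \<open>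
  The five vectors \<open>u, v1, \<dots>, v4\<close> in a space of dimension four satisfy this relation (Cramer's rule).
\<close>

lemma det4_cramer:
  "det4 v1 v2 v3 v4 *s u - det4 u v2 v3 v4 *s v1 + det4 u v1 v3 v4 *s v2
   - det4 u v1 v2 v4 *s v3 + det4 u v1 v2 v3 *s v4 = 0"
  unfolding vec_eq_iff forall_4 by (simp add: det4_expand algebra_simps)

lemma det4_first_row:
  "det4 u v s t = (\<Sum>j\<in>UNIV. u $ j * det4 (axis j 1) v s t)"
  by (simp add: det4_expand sum_4 axis_def algebra_simps)

lemma det4_add:
  "det4 u (v + v') s t = det4 u v s t + det4 u v' s t"
  "det4 u v (s + s') t = det4 u v s t + det4 u v s' t"
  "det4 u v s (t + t') = det4 u v s t + det4 u v s t'"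
  by (simp_all add: det4_expand algebra_simps)

lemma det4_scale:
  "det4 u (c *s v) s t = c * det4 u v s t"
  "det4 u v (c *s s) t = c * det4 u v s t"
  "det4 u v s (c *s t) = c * det4 u v s t"
  by (simp_all add: det4_expand algebra_simps)

lemma det4_repeated:
  "det4 u v v t = 0" "det4 u v s v = 0" "det4 u v s s = 0"
  by (simp_all add: det4_expand algebra_simps)

lemma det4_swap:
  "det4 u s v t = - det4 u v s t" "det4 u v t s = - det4 u v s t"
  by (simp_all add: det4_expand algebra_simps)

text \<open>
  The vectors that make the determinant divisible by \<open>q\<close> form a submodule, separately in each row.
\<close>

lemma dvd_det4_span:
  fixes R :: "(S^4) set"
  defines "V \<equiv> module.span (*s) R"
  assumes R: "\<And>x y z. x \<in> R \<Longrightarrow> y \<in> R \<Longrightarrow> z \<in> R \<Longrightarrow> q dvd det4 u x y z"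
    and v: "v \<in> V" "s \<in> V" "t \<in> V"
  shows "q dvd det4 u v s t"
proof -
  note induct = module.span_induct[OF module_S_vec] and sub = module.subspaceI[OF module_S_vec]
  have zero: "det4 u 0 y z = 0" "det4 u x 0 z = 0" "det4 u x y 0 = 0" for x y z
    by (simp_all add: det4_expand)
  have 1: "q dvd det4 u x y z" if "x \<in> R" "y \<in> R" "z \<in> V" for x y z
    using that(3) unfolding V_def
    by (rule induct[of _ _ "\<lambda>z. q dvd det4 u x y z"])
      (use R that(1,2) in \<open>auto intro!: sub simp: zero det4_add det4_scale\<close>)
  have 2: "q dvd det4 u x y z" if "x \<in> R" "y \<in> V" "z \<in> V" for x y z
    using that(2) unfolding V_def
    by (rule induct[of _ _ "\<lambda>y. q dvd det4 u x y z"])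
      (use 1 that(1,3) in \<open>auto intro!: sub simp: zero det4_add det4_scale\<close>)
  show ?thesis
    using v(1) unfolding V_def
    by (rule induct[of _ _ "\<lambda>x. q dvd det4 u x s t"])
      (use 2 v(2,3) in \<open>auto intro!: sub simp: zero det4_add det4_scale\<close>)
qed

lemma sum_1_4: "(\<Sum>i=1..4. F i) = F 1 + F 2 + F 3 + F (4::nat)"
  by (simp add: eval_nat_numeral ac_simps)

lemma ball_1_4: "(\<forall>i\<in>{1..4::nat}. P i) \<longleftrightarrow> P 1 \<and> P 2 \<and> P 3 \<and> P 4"
proof -
  have "{1..4::nat} = {1, 2, 3, 4}" by auto
  then show ?thesis by simp
qed

text \<open>
  The determinant \<open>phi r i\<close> with an arbitrary vector \<open>u\<close> in place of the vector of the coordinates. For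
  \<open>u\<close> a unit vector it is, up to sign, a maximal minor of the matrix with rows \<open>r j\<close> for \<open>j \<noteq> i\<close>.
\<close>

definition minor :: "S^4 \<Rightarrow> (nat \<Rightarrow> S^4) \<Rightarrow> nat \<Rightarrow> S" where
  "minor u r i = det (vector (map (r(0 := u)) (remove1 i [0..<5])) :: S^4^4)"

lemma phi_eq_minor: "phi r i = minor coord_vec r i"
  by (simp add: phi_def minor_def)

lemma minor_simps:
  "minor u r 1 = det4 u (r 2) (r 3) (r 4)" "minor u r 2 = det4 u (r 1) (r 3) (r 4)"
  "minor u r 3 = det4 u (r 1) (r 2) (r 4)" "minor u r 4 = det4 u (r 1) (r 2) (r 3)"
proof -
  have "[0..<5] = [0, 1, 2, 3, 4::nat]" by (simp add: upt_rec)
  then show "minor u r 1 = det4 u (r 2) (r 3) (r 4)" "minor u r 2 = det4 u (r 1) (r 3) (r 4)"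
    "minor u r 3 = det4 u (r 1) (r 2) (r 4)" "minor u r 4 = det4 u (r 1) (r 2) (r 3)"
    by (simp_all add: minor_def)
qed

lemma minor_first_row:
  assumes "i \<in> {1..4}"
  shows "minor u r i = (\<Sum>j\<in>UNIV. u $ j * minor (axis j 1) r i)"
proof -
  have "\<forall>i\<in>{1..4}. minor u r i = (\<Sum>j\<in>UNIV. u $ j * minor (axis j 1) r i)"
    unfolding ball_1_4 minor_simps using det4_first_row by blast
  with assms show ?thesis by blast
qed

\<comment> \<open>the index \<open>1\<close> of a generator would otherwise be rewritten to \<open>Suc 0\<close>\<close>
declare One_nat_def [simp del]

text \<open>
  The determinant alternates, so for rows among the \<open>r i\<close> it is zero or a minor up to sign.
\<close>

lemma dvd_det4_if_dvd_minors:
  assumes q: "\<And>i. i \<in> {1..4} \<Longrightarrow> q dvd minor u r i"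
    and v: "v \<in> module.span (*s) (r ` {1..4})" "s \<in> module.span (*s) (r ` {1..4})"
      "t \<in> module.span (*s) (r ` {1..4})"
  shows "q dvd det4 u v s t"
proof (rule dvd_det4_span[OF _ v])
  fix x y z assume xyz: "x \<in> r ` {1..4}" "y \<in> r ` {1..4}" "z \<in> r ` {1..4}"
  have r: "r ` {1..4} = {r 1, r 2, r 3, r 4}"
  proof -
    have "{1..4::nat} = {1, 2, 3, 4}" by auto
    then show ?thesis by simp
  qed
  define P where "P = (\<lambda>a b c. q dvd det4 u a b c)"
  have diag: "P a a b" "P a b a" "P b a a" for a b
    by (simp_all add: P_def det4_repeated)
  have swap: "P b a c" "P a c b" if "P a b c" for a b c
    using that by (simp_all add: P_def det4_swap(1)[of u b a c] det4_swap(2)[of u a c b])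
  have perms: "P a c b \<and> P b a c \<and> P b c a \<and> P c a b \<and> P c b a" if "P a b c" for a b c
    using that by (meson swap)
  have m: "P (r 2) (r 3) (r 4)" "P (r 1) (r 3) (r 4)" "P (r 1) (r 2) (r 4)" "P (r 1) (r 2) (r 3)"
    using q unfolding P_def minor_simps[symmetric] by simp_all
  have "\<forall>x\<in>{r 1, r 2, r 3, r 4}. \<forall>y\<in>{r 1, r 2, r 3, r 4}. \<forall>z\<in>{r 1, r 2, r 3, r 4}. P x y z"
    by (simp add: diag m perms[OF m(1)] perms[OF m(2)] perms[OF m(3)] perms[OF m(4)])
  then show "q dvd det4 u x y z"
    using xyz unfolding r P_def by blast
qed

text \<open>
  The syzygies of \<open>g\<close> that come from the commutativity of multiplication.
\<close>

definition koszul :: "(4 \<Rightarrow> S) \<Rightarrow> 4 \<Rightarrow> 4 \<Rightarrow> S^4" where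
  "koszul g j k = g j *s axis k 1 - g k *s axis j 1"

text \<open>
  The three Koszul syzygies \<open>koszul g j k\<close> with \<open>k \<noteq> j\<close> have \<open>g j\<close> on the diagonal outside column \<open>j\<close>,
  so together with the \<open>j\<close>-th unit vector they have determinant \<open>\<plusminus> g j ^ 3\<close>.
\<close>

lemma dvd_det4_koszul:
  assumes "\<And>a b c. q dvd det4 (axis j 1) (koszul g j a) (koszul g j b) (koszul g j c)"
  shows "q dvd g j ^ 3"
proof -
  have "\<forall>j. \<exists>a b c. det4 (axis j 1) (koszul g j a) (koszul g j b) (koszul g j c) = g j ^ 3 \<or>
     det4 (axis j 1) (koszul g j a) (koszul g j b) (koszul g j c) = - (g j ^ 3)"
    unfolding forall_4
  proof (intro conjI)
    show "\<exists>a b c. det4 (axis 1 1) (koszul g 1 a) (koszul g 1 b) (koszul g 1 c) = g 1 ^ 3 \<or>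
     det4 (axis 1 1) (koszul g 1 a) (koszul g 1 b) (koszul g 1 c) = - (g 1 ^ 3)"
      by (rule exI[of _ 2], rule exI[of _ 3], rule exI[of _ 4])
        (simp add: koszul_def det4_expand axis_def power3_eq_cube)
    show "\<exists>a b c. det4 (axis 2 1) (koszul g 2 a) (koszul g 2 b) (koszul g 2 c) = g 2 ^ 3 \<or>
     det4 (axis 2 1) (koszul g 2 a) (koszul g 2 b) (koszul g 2 c) = - (g 2 ^ 3)"
      by (rule exI[of _ 1], rule exI[of _ 3], rule exI[of _ 4])
        (simp add: koszul_def det4_expand axis_def power3_eq_cube)
    show "\<exists>a b c. det4 (axis 3 1) (koszul g 3 a) (koszul g 3 b) (koszul g 3 c) = g 3 ^ 3 \<or>
     det4 (axis 3 1) (koszul g 3 a) (koszul g 3 b) (koszul g 3 c) = - (g 3 ^ 3)"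
      by (rule exI[of _ 1], rule exI[of _ 2], rule exI[of _ 4])
        (simp add: koszul_def det4_expand axis_def power3_eq_cube)
    show "\<exists>a b c. det4 (axis 4 1) (koszul g 4 a) (koszul g 4 b) (koszul g 4 c) = g 4 ^ 3 \<or>
     det4 (axis 4 1) (koszul g 4 a) (koszul g 4 b) (koszul g 4 c) = - (g 4 ^ 3)"
      by (rule exI[of _ 1], rule exI[of _ 2], rule exI[of _ 3])
        (simp add: koszul_def det4_expand axis_def power3_eq_cube)
  qed
  then show ?thesis using assms by (metis dvd_minus_iff)
qed

section \<open>Syzygy modules with four generators\<close>

text \<open>
  Here \<open>g\<close> stands for the gradient of a reduced polynomial, and the span equation says that the \<open>r i\<close> with
  \<open>1 \<le> i \<le> 4\<close> generate its syzygies.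
\<close>

locale four_syzygies =
  fixes g :: "4 \<Rightarrow> S" and r :: "nat \<Rightarrow> S^4"
  assumes coprime: "coprime_family UNIV g" and nonzero: "\<exists>j. g j \<noteq> 0"
    and span: "module.span (*s) (r ` {1..4}) = {b. (\<Sum>i\<in>UNIV. b $ i * g i) = 0}"
begin

definition dot :: "S^4 \<Rightarrow> S" where "dot u = (\<Sum>i\<in>UNIV. u $ i * g i)"

lemma dot_add: "dot (u + v) = dot u + dot v"
  by (simp add: dot_def algebra_simps sum.distrib)
lemma dot_diff: "dot (u - v) = dot u - dot v"
  by (simp add: dot_def algebra_simps sum_subtractf)
lemma dot_scale: "dot (c *s u) = c * dot u"
  by (simp add: dot_def sum_distrib_left mult.assoc)
lemma dot_axis: "dot (axis j 1) = g j"
proof -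
  have "dot (axis j 1) = (\<Sum>i\<in>UNIV. if i = j then g i else 0)"
    unfolding dot_def axis_def by (intro sum.cong) auto
  then show ?thesis by simp
qed

lemma span_iff: "v \<in> module.span (*s) (r ` {1..4}) \<longleftrightarrow> dot v = 0"
  unfolding span dot_def by simp

lemma dot_r: "i \<in> {1..4} \<Longrightarrow> dot (r i) = 0"
  unfolding span_iff[symmetric] by (intro module.span_base[OF module_S_vec] imageI)

lemma dot_koszul: "dot (koszul g j k) = 0"
  by (simp add: koszul_def dot_diff dot_scale dot_axis)

text \<open>
  Syzygies of a nonzero vector span a space of dimension at most three. Pairing Cramer's relation
  for \<open>u = axis j 1\<close> with \<open>g\<close> leaves the determinant times \<open>g j\<close>.
\<close>

lemma det4_syzygies:
  assumes "dot v1 = 0" "dot v2 = 0" "dot v3 = 0" "dot v4 = 0"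
  shows "det4 v1 v2 v3 v4 = 0"
proof -
  obtain j where j: "g j \<noteq> 0" using nonzero by blast
  have "dot (det4 v1 v2 v3 v4 *s axis j 1) = 0"
    using arg_cong[OF det4_cramer[of v1 v2 v3 v4 "axis j 1"], of dot] assms
    by (simp add: dot_add dot_diff dot_scale) (simp add: dot_def)
  then show ?thesis using j by (simp add: dot_scale dot_axis)
qed

lemma minor_syzygy:
  assumes "dot v = 0" "i \<in> {1..4}"
  shows "minor v r i = 0"
proof -
  have "\<forall>i\<in>{1..4}. minor v r i = 0"
    unfolding ball_1_4 minor_simps using assms(1) dot_r by (auto intro!: det4_syzygies)
  with assms(2) show ?thesis by blast
qed

text \<open>
  As a linear form in \<open>u\<close> the minor vanishes on all syzygies of \<open>g\<close>, in particular on the Koszul ones;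
  hence its coefficient vector is proportional to \<open>g\<close>, and a multiple of \<open>g\<close> as \<open>g\<close> is coprime.
\<close>

lemma minor_factor:
  assumes i: "i \<in> {1..4}"
  shows "\<exists>h. \<forall>u. minor u r i = h * dot u"
proof -
  obtain k where k: "g k \<noteq> 0" using nonzero by blast
  define v where "v = (\<lambda>j. minor (axis j 1) r i)"
  have lin: "minor u r i = (\<Sum>j\<in>UNIV. u $ j * v j)" for u
    unfolding v_def using i by (rule minor_first_row)
  have cross: "v j * g k = v k * g j" for j
  proof -
    have "0 = (\<Sum>l\<in>UNIV. koszul g k j $ l * v l)"
      using minor_syzygy[OF dot_koszul i, of k j] by (simp add: lin)
    also have "\<dots> = (\<Sum>l\<in>UNIV. (if l = j then g k * v l else 0) - (if l = k then g j * v l else 0))"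
      by (intro sum.cong) (auto simp: koszul_def axis_def algebra_simps)
    also have "\<dots> = g k * v j - g j * v k" by (simp add: sum_subtractf)
    finally show ?thesis by (simp add: algebra_simps)
  qed
  have "\<exists>h. \<forall>j\<in>UNIV. v j = h * g j"
    by (rule proportional_to_coprime_family[OF coprime UNIV_I k cross])
  then obtain h where h: "\<And>j. v j = h * g j" by blast
  have "minor u r i = h * dot u" for u
    by (simp add: lin h dot_def sum_distrib_left algebra_simps)
  then show ?thesis by blast
qed

text \<open>
  The polynomial \<open>H i\<close> of the introduction; it is determined by its equation, since \<open>dot\<close> is not zero.
\<close>

definition quotient_minor :: "nat \<Rightarrow> S" where
  "quotient_minor i = (SOME h. \<forall>u. minor u r i = h * dot u)"

lemma minor_eq: "i \<in> {1..4} \<Longrightarrow> minor u r i = quotient_minor i * dot u"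
  unfolding quotient_minor_def using someI_ex[OF minor_factor] by blast

text \<open>
  Were the quotients to have a common divisor \<open>q\<close>, it would divide all minors, hence the
  determinants of the Koszul syzygies, which are combinations of the generators. These are the cubes of
  the entries of \<open>g\<close>.
\<close>

lemma coprime_quotient_minors: "coprime_family {1..4} quotient_minor"
  unfolding coprime_family_def
proof (intro allI impI)
  fix q assume q: "\<forall>i\<in>{1..4}. q dvd quotient_minor i"
  obtain k where k: "g k \<noteq> 0" using nonzero by blast
  have "q dvd g j ^ 3" for j
  proof (rule dvd_det4_koszul, rule dvd_det4_if_dvd_minors)
    fix i :: nat assume "i \<in> {1..4}"
    then show "q dvd minor (axis j 1) r i" using q by (simp add: minor_eq)
  qed (rule span_iff[THEN iffD2, OF dot_koszul])+
  then show "q dvd 1" by (rule unit_if_dvd_powers[OF coprime UNIV_I k])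
qed

text \<open>
  Cramer's relation among the generators, divided by \<open>g\<close> and hence primitive.
\<close>

definition relation :: "nat \<Rightarrow> S" where
  "relation i = (-1) ^ i * quotient_minor i"

lemma coprime_relation: "coprime_family {1..4} relation"
proof -
  have "q dvd relation i \<longleftrightarrow> q dvd quotient_minor i" for q i
    by (cases "even i") (simp_all add: relation_def)
  then show ?thesis using coprime_quotient_minors by (simp add: coprime_family_def)
qed

lemma relation_nonzero: "\<exists>i\<in>{1..4}. relation i \<noteq> 0"
proof (rule ccontr)
  assume "\<not> ?thesis"
  then have "(0::S) dvd 1" using coprime_relation unfolding coprime_family_def by simp
  then show False by simp
qed

lemma relation_holds: "(\<Sum>i=1..4. relation i *s r i) = 0"
proof -
  obtain k where k: "g k \<noteq> 0" using nonzero by blast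
  have "det4 (r 1) (r 2) (r 3) (r 4) = 0" by (intro det4_syzygies dot_r) auto
  then have "minor (axis k 1) r 4 *s r 4 - minor (axis k 1) r 3 *s r 3
      + minor (axis k 1) r 2 *s r 2 - minor (axis k 1) r 1 *s r 1 = 0"
    using det4_cramer[of "r 1" "r 2" "r 3" "r 4" "axis k 1"]
    by (simp add: minor_simps algebra_simps)
  then have "g k *s (\<Sum>i=1..4. relation i *s r i) = 0"
    by (simp add: sum_1_4 minor_eq dot_axis relation_def vec_eq_iff algebra_simps)
  then show ?thesis using k by (simp add: vec_eq_iff)
qed

text \<open>
  Substituting a vanishing combination of the generators into one row of the determinant, with two of
  the generators in the other rows, leaves a linear relation between two minors.
\<close>

lemma relation_cross:
  assumes b: "(\<Sum>i=1..4. b i *s r i) = 0"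
  shows "\<forall>i\<in>{1..4}. \<forall>j\<in>{1..4}. b i * relation j = b j * relation i"
proof -
  obtain k where k: "g k \<noteq> 0" using nonzero by blast
  define M where "M = minor (axis k 1) r"
  have rel: "b 1 *s r 1 + b 2 *s r 2 + b 3 *s r 3 + b 4 *s r 4 = 0"
    using b by (simp add: sum_1_4)
  have zero: "det4 (axis k 1) 0 s t = 0" for s t by (simp add: det4_expand)
  have expand: "b 1 * det4 (axis k 1) (r 1) s t + b 2 * det4 (axis k 1) (r 2) s t
      + b 3 * det4 (axis k 1) (r 3) s t + b 4 * det4 (axis k 1) (r 4) s t = 0" for s t
    using arg_cong[OF rel, of "\<lambda>v. det4 (axis k 1) v s t"]
    by (simp add: zero det4_add det4_scale)
  note swap = det4_swap[of "axis k 1"]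
  have "b 1 * M 2 = - (b 2 * M 1)" "b 1 * M 3 = b 3 * M 1" "b 1 * M 4 = - (b 4 * M 1)"
    "b 3 * M 2 = - (b 2 * M 3)" "b 2 * M 4 = b 4 * M 2" "b 3 * M 4 = - (b 4 * M 3)"
    using expand[of "r 3" "r 4"] expand[of "r 2" "r 4"] expand[of "r 2" "r 3"]
      expand[of "r 1" "r 4"] expand[of "r 1" "r 3"] expand[of "r 1" "r 2"]
    unfolding M_def minor_simps
    by (simp_all add: det4_repeated swap(1)[of "r 3" "r 2"] swap(1)[of "r 4" "r 2"] swap(1)[of "r 2" "r 1"]
        swap(1)[of "r 3" "r 1"] swap(1)[of "r 4" "r 1"] swap(2)[of _ "r 3" "r 2"] swap(2)[of _ "r 4" "r 2"] swap(2)[of _ "r 4" "r 3"]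
        add_eq_0_iff)
  moreover have "g k * relation i = (-1) ^ i * M i" if "i \<in> {1..4}" for i
    using that by (simp add: M_def minor_eq dot_axis relation_def algebra_simps)
  ultimately have "\<forall>i\<in>{1..4}. \<forall>j\<in>{1..4}. g k * (b i * relation j) = g k * (b j * relation i)"
    unfolding ball_1_4 mult.left_commute[of "g k"]
    by (simp)
  then show ?thesis using k by simp
qed

text \<open>
  The relations form a module of rank one, so any of them is proportional to \<open>relation\<close>; it is a
  multiple because \<open>relation\<close> is coprime.
\<close>

theorem generates_relations_relation: "generates_relations r relation"
  unfolding generates_relations_def
proof (intro allI iffI)
  fix b assume b: "(\<Sum>i=1..4. b i *s r i) = 0"
  obtain l where l: "l \<in> {1..4}" "relation l \<noteq> 0" using relation_nonzero by blast
  have "b j * relation l = b l * relation j" if "j \<in> {1..4}" for j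
    using relation_cross[OF b] that l(1) by blast
  then show "\<exists>h. \<forall>i\<in>{1..4}. b i = h * relation i"
    by (rule proportional_to_coprime_family[OF coprime_relation l])
next
  fix b assume "\<exists>h. \<forall>i\<in>{1..4}. b i = h * relation i"
  then obtain h where h: "\<forall>i\<in>{1..4}. b i = h * relation i" by blast
  have "(\<Sum>i=1..4. b i *s r i) = h *s (\<Sum>i=1..4. relation i *s r i)"
    using h unfolding ball_1_4 by (simp add: sum_1_4 vec_eq_iff algebra_simps)
  then show "(\<Sum>i=1..4. b i *s r i) = 0" by (simp add: relation_holds)
qed

text \<open>
  Two generators of a module that is free of rank one differ by a unit, that is, by a constant.
\<close>

lemma generates_relations_unique:
  assumes "generates_relations r a"
  shows "\<exists>c. c \<noteq> 0 \<and> (\<forall>i\<in>{1..4}. relation i = Const c * a i)"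
proof -
  have "\<exists>h. \<forall>i\<in>{1..4}. a i = h * a i" by (rule exI[of _ 1]) simp
  then have "(\<Sum>i=1..4. a i *s r i) = 0"
    using assms unfolding generates_relations_def by simp
  then obtain h' where h': "\<forall>i\<in>{1..4}. a i = h' * relation i"
    using generates_relations_relation unfolding generates_relations_def by blast
  obtain h where h: "\<forall>i\<in>{1..4}. relation i = h * a i"
    using assms relation_holds unfolding generates_relations_def by blast
  obtain l where l: "l \<in> {1..4}" "relation l \<noteq> 0" using relation_nonzero by blast
  have "relation l = h * a l" using h l(1) by blast
  also have "a l = h' * relation l" using h' l(1) by blast
  finally have "1 * relation l = h * h' * relation l" by (simp add: mult.assoc)
  then have "1 = h * h'" using l(2) by (simp only: mult_cancel_right) simp
  then have "h dvd 1" by (rule dvdI)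
  then obtain c where "c \<noteq> 0" "h = Const c" by (rule S_unit_Const)
  with h show ?thesis by blast
qed

end

section \<open>Graded syzygies of a reduced surface\<close>

lemma homogeneous_det4:
  assumes "homogeneous_vec k1 u" "homogeneous_vec k2 v" "homogeneous_vec k3 s" "homogeneous_vec k4 t"
  shows "homogeneous (k1 + (k2 + (k3 + k4))) (det4 u v s t)"
  unfolding det4_expand using assms[unfolded homogeneous_vec_def]
  by (intro homogeneous_add homogeneous_diff homogeneous_mult) blast+

lemma homogeneous_minor:
  assumes "homogeneous_vec 0 u" "\<And>i. i \<in> {1..4} \<Longrightarrow> homogeneous_vec (e i) (r i)" "i \<in> {1..4}"
  shows "homogeneous (e 1 + e 2 + e 3 + e 4 - e i) (minor u r i)"
proof -
  note hom = homogeneous_det4[OF assms(1)] assms(2)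
  have "\<forall>i\<in>{1..4}. homogeneous (e 1 + e 2 + e 3 + e 4 - e i) (minor u r i)"
    unfolding ball_1_4 minor_simps
    using hom(1)[OF hom(2) hom(2) hom(2), of 2 3 4] hom(1)[OF hom(2) hom(2) hom(2), of 1 3 4]
      hom(1)[OF hom(2) hom(2) hom(2), of 1 2 4] hom(1)[OF hom(2) hom(2) hom(2), of 1 2 3]
    by (simp add: algebra_simps)
  with assms(3) show ?thesis by blast
qed

lemma (in four_syzygies) homogeneous_quotient_minor:
  assumes g: "\<And>j. homogeneous k (g j)"
    and r: "\<And>i. i \<in> {1..4} \<Longrightarrow> homogeneous_vec (e i) (r i)" and i: "i \<in> {1..4}"
  shows "homogeneous (e 1 + e 2 + e 3 + e 4 - e i - k) (quotient_minor i)"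
proof -
  obtain j where j: "g j \<noteq> 0" using nonzero by blast
  have "homogeneous_vec 0 (axis j 1)"
    using homogeneous_Const[of 1] by (simp add: homogeneous_vec_def axis_def)
  then have "homogeneous (e 1 + e 2 + e 3 + e 4 - e i) (minor (axis j 1) r i)"
    using r i by (rule homogeneous_minor)
  then have "homogeneous (e 1 + e 2 + e 3 + e 4 - e i) (quotient_minor i * g j)"
    by (simp only: minor_eq[OF i] dot_axis)
  then show ?thesis using homogeneous_cancel_right[OF _ g j] by blast
qed

lemma four_syzygies_gradient:
  assumes "reduced_surface f d" "generates_AR f r"
  shows "four_syzygies (\<lambda>j. pdiff j f) r"
proof
  show "coprime_family UNIV (\<lambda>j. pdiff j f)" using assms(1) by (rule coprime_gradient)
  show "\<exists>j. pdiff j f \<noteq> 0" using assms(1) by (metis gradient_nonzero)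
  show "module.span (*s) (r ` {1..4}) = {b. (\<Sum>i\<in>UNIV. b $ i * pdiff i f) = 0}"
    using assms(2) by (simp add: generates_AR_def AR_def)
qed

lemma phi_eq_quotient_minor:
  assumes f: "reduced_surface f d" and r: "generates_AR f r" and i: "i \<in> {1..4}"
  shows "phi r i = four_syzygies.quotient_minor (\<lambda>j. pdiff j f) r i * (of_nat d * f)"
proof -
  interpret four_syzygies "\<lambda>j. pdiff j f" r by (rule four_syzygies_gradient[OF f r])
  have "\<forall>j. coord_vec $ j = Var j"
    by (simp add: forall_4 coord_vec_def vector_4)
  then have "dot coord_vec = of_nat d * f"
    using f by (simp add: dot_def euler_formula reduced_surface_def)
  then show ?thesis by (simp add: phi_eq_minor minor_eq[OF i])
qed

text \<open>
  A plane is a cone: its gradient is a constant vector, which is orthogonal to a nonzero constant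
  vector.
\<close>

lemma not_cone_degree_ge_2:
  assumes f: "reduced_surface f d" and nc: "\<not> is_cone f"
  shows "d \<ge> 2"
proof (rule ccontr)
  assume "\<not> d \<ge> 2"
  then have "d = 1" using f by (simp add: reduced_surface_def)
  then have "homogeneous 0 (pdiff j f)" for j
    using homogeneous_pdiff[of 1 f j] f by (simp add: reduced_surface_def)
  then have "\<forall>j. \<exists>c. pdiff j f = Const c" by (metis homogeneous_0_imp_Const)
  then obtain c where c: "\<And>j. pdiff j f = Const (c j)" by metis
  have "is_cone f"
  proof (cases "c 1 = 0")
    case True
    show ?thesis
    proof (rule is_cone_if_constant_syzygy)
      show "axis 1 1 \<noteq> (0 :: complex^4)" by (simp add: axis_eq_0_iff)
    qed (simp add: c True sum_4 axis_def)
  next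
    case False
    have "(axis 1 (c 2) - axis 2 (c 1) :: complex^4) $ 2 \<noteq> 0" using False by (simp add: axis_def)
    then have "(axis 1 (c 2) - axis 2 (c 1) :: complex^4) \<noteq> 0" by (metis zero_index)
    moreover have "Const (- x) = - Const x" for x by (simp add: Const_def single_uminus)
    ultimately show ?thesis
      by (intro is_cone_if_constant_syzygy[of "axis 1 (c 2) - axis 2 (c 1)"])
        (simp_all add: c sum_4 axis_def)
  qed
  with nc show False by blast
qed

text \<open>
  A syzygy of degree zero has constant entries. Applied to \<open>r 1\<close> this gives \<open>d1 \<ge> 1\<close>, which makes the second
  map of the resolution minimal.
\<close>

lemma not_cone_degree_syzygy_pos:
  assumes nc: "\<not> is_cone f" and v: "v \<in> AR f" "v \<noteq> 0" "homogeneous_vec (int e) v"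
  shows "e \<ge> 1"
proof (rule ccontr)
  assume "\<not> e \<ge> 1"
  then have "\<forall>j. \<exists>c. v $ j = Const c"
    using v(3) by (metis homogeneous_0_imp_Const homogeneous_vec_def less_one not_le of_nat_0)
  then obtain c where c: "\<And>j. v $ j = Const (c j)" by metis
  have "is_cone f"
  proof (rule is_cone_if_constant_syzygy[of "\<chi> j. c j"])
    show "(\<chi> j. c j) \<noteq> 0" using v(2) c by (auto simp: vec_eq_iff)
    show "(\<Sum>k\<in>UNIV. Const ((\<chi> j. c j) $ k) * pdiff k f) = 0"
      using v(1) by (simp add: AR_def c)
  qed
  with nc show False by blast
qed

lemma span_four:
  fixes sc :: "'a::comm_ring_1 \<Rightarrow> 'b::ab_group_add \<Rightarrow> 'b"
  assumes "module sc"
  shows "module.span sc {a, b, c, d} =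
    {sc k1 a + sc k2 b + sc k3 c + sc k4 d | k1 k2 k3 k4. True}"
proof -
  interpret module sc by fact
  have "x \<in> span {a, b, c, d} \<longleftrightarrow>
      (\<exists>k1 k2 k3 k4. x = sc k1 a + sc k2 b + sc k3 c + sc k4 d)" for x
  proof -
    have "x - sc k1 a - sc k2 b - sc k3 c - sc k4 d = 0 \<longleftrightarrow>
       x = sc k1 a + sc k2 b + sc k3 c + sc k4 d" for k1 k2 k3 k4
      by (simp add: algebra_simps)
    then show ?thesis by (simp add: span_insert)
  qed
  then show ?thesis by blast
qed

text \<open>
  The maps are the gradient, the matrix with columns \<open>r 1, \<dots>, r 4\<close>, and the column \<open>a 1, \<dots>, a 4\<close>.
  Exactness restates that \<open>r\<close> generates the syzygies and \<open>a\<close> the relations; minimality holds because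
  every entry has positive degree.
\<close>

lemma has_minimal_resolution_gradient:
  assumes f: "reduced_surface f d" and d: "d \<ge> 2"
    and r: "generates_AR f r" "homogeneous_generators r d1 d2 d3"
    and deg: "1 \<le> d1" "d1 \<le> d2" "d2 \<le> d3"
    and a: "generates_relations r a" "homogeneous_relation a d1 d2 d3" "\<exists>i\<in>{1..4}. a i \<noteq> 0"
  shows "has_minimal_resolution (jacobian_ideal f)
       (vec (int d - 1) :: int^4)
       (vector [int d1 + (int d - 1), int d2 + (int d - 1),
                int d3 + (int d - 1), int d3 + (int d - 1)] :: int^4)
       (vec (int d3 + int d) :: int^1)"
proof -
  define A1 :: "S^4^1" where "A1 = (\<chi> _ j. pdiff j f)"
  define A2 :: "S^4^4" where "A2 = (\<chi> j i. (vector [r 1, r 2, r 3, r 4] :: S^4^4) $ i $ j)"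
  define A3 :: "S^1^4" where "A3 = (\<chi> i _. (vector [a 1, a 2, a 3, a 4] :: S^4) $ i)"
  have A1: "(A1 *v u) $ k = (\<Sum>j\<in>UNIV. u $ j * pdiff j f)" for u k
    by (simp add: A1_def matrix_vector_mult_def mult.commute)
  have A2: "A2 *v u = u $ 1 *s r 1 + u $ 2 *s r 2 + u $ 3 *s r 3 + u $ 4 *s r 4" for u
    by (simp add: A2_def matrix_vector_mult_def vec_eq_iff sum_4 vector_4 mult.commute)
  have A3: "A3 *v v = vector [v $ 1 * a 1, v $ 1 * a 2, v $ 1 * a 3, v $ 1 * a 4]" for v
    by (simp add: A3_def matrix_vector_mult_def vec_eq_iff forall_4 vector_4 mult.commute)
  have hom_f: "homogeneous (int d - 1) (pdiff j f)" for j
    using f homogeneous_pdiff by (simp add: reduced_surface_def)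
  have hom_r: "homogeneous (int d1) (r 1 $ j)" "homogeneous (int d2) (r 2 $ j)"
      "homogeneous (int d3) (r 3 $ j)" "homogeneous (int d3) (r 4 $ j)" for j
    using r(2) by (auto simp: homogeneous_generators_def homogeneous_vec_def)
  have hom_a: "homogeneous (int d3 - int d1 + 1) (a 1)" "homogeneous (int d3 - int d2 + 1) (a 2)"
      "homogeneous 1 (a 3)" "homogeneous 1 (a 4)"
    using a(2) by (auto simp: homogeneous_relation_def)
  have "graded_map 0 (vec (int d - 1)) A1"
    using hom_f by (simp add: graded_map_def A1_def)
  moreover have "graded_map (vec (int d - 1)) (vector [int d1 + (int d - 1), int d2 + (int d - 1),
                int d3 + (int d - 1), int d3 + (int d - 1)] :: int^4) A2"
    unfolding graded_map_def A2_def using hom_r by (simp add: forall_4 vector_4)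
  moreover have "graded_map (vector [int d1 + (int d - 1), int d2 + (int d - 1),
                int d3 + (int d - 1), int d3 + (int d - 1)] :: int^4) (vec (int d3 + int d) :: int^1) A3"
    unfolding graded_map_def A3_def using hom_a by (simp add: forall_4 vector_4 algebra_simps)
  moreover have "minimal_map A1"
    unfolding minimal_map_def A1_def
    using homogeneous_in_irrelevant_ideal[OF hom_f] d by simp
  moreover have "minimal_map A2"
    unfolding minimal_map_def A2_def
    using homogeneous_in_irrelevant_ideal[OF hom_r(1)] homogeneous_in_irrelevant_ideal[OF hom_r(2)]
      homogeneous_in_irrelevant_ideal[OF hom_r(3)] homogeneous_in_irrelevant_ideal[OF hom_r(4)] deg
    by (simp add: forall_4 vector_4)
  moreover have "minimal_map A3"
    unfolding minimal_map_def A3_def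
    using homogeneous_in_irrelevant_ideal[OF hom_a(1)] homogeneous_in_irrelevant_ideal[OF hom_a(2)]
      homogeneous_in_irrelevant_ideal[OF hom_a(3)] homogeneous_in_irrelevant_ideal[OF hom_a(4)] deg
    by (simp add: forall_4 vector_4)
  moreover have "range (\<lambda>u. (A1 *v u) $ 1) = jacobian_ideal f"
  proof -
    have "range (\<lambda>i. pdiff i f) = {pdiff 1 f, pdiff 2 f, pdiff 3 f, pdiff 4 f}"
      by (simp add: UNIV_4)
    then have *: "jacobian_ideal f = {k1 * pdiff 1 f + k2 * pdiff 2 f + k3 * pdiff 3 f + k4 * pdiff 4 f | k1 k2 k3 k4. True}"
      unfolding jacobian_ideal_def using span_four[OF module_S] by simp
    show ?thesis
    proof
      show "range (\<lambda>u. (A1 *v u) $ 1) \<subseteq> jacobian_ideal f" unfolding * A1 sum_4 by blast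
      show "jacobian_ideal f \<subseteq> range (\<lambda>u. (A1 *v u) $ 1)"
      proof
        fix x assume "x \<in> jacobian_ideal f"
        then obtain k1 k2 k3 k4 where "x = k1 * pdiff 1 f + k2 * pdiff 2 f + k3 * pdiff 3 f + k4 * pdiff 4 f"
          unfolding * by blast
        then have "x = (A1 *v vector [k1, k2, k3, k4]) $ 1" by (simp add: A1 sum_4 vector_4)
        then show "x \<in> range (\<lambda>u. (A1 *v u) $ 1)" by blast
      qed
    qed
  qed
  moreover have "{u. A1 *v u = 0} = range (\<lambda>v. A2 *v v)"
  proof -
    have "{u. A1 *v u = 0} = AR f" by (simp add: vec_eq_iff A1 AR_def)
    also have "\<dots> = module.span (*s) {r 1, r 2, r 3, r 4}"
    proof -
      have "{1..4::nat} = {1, 2, 3, 4}" by auto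
      then show ?thesis using r(1) by (simp add: generates_AR_def)
    qed
    also have "\<dots> = {k1 *s r 1 + k2 *s r 2 + k3 *s r 3 + k4 *s r 4 | k1 k2 k3 k4. True}"
      by (rule span_four[OF module_S_vec])
    also have "\<dots> = range (\<lambda>v. A2 *v v)"
    proof
      show "{k1 *s r 1 + k2 *s r 2 + k3 *s r 3 + k4 *s r 4 | k1 k2 k3 k4. True} \<subseteq> range (\<lambda>v. A2 *v v)"
      proof clarify
        fix k1 k2 k3 k4
        have "k1 *s r 1 + k2 *s r 2 + k3 *s r 3 + k4 *s r 4 = A2 *v vector [k1, k2, k3, k4]"
          by (simp add: A2 vector_4)
        then show "k1 *s r 1 + k2 *s r 2 + k3 *s r 3 + k4 *s r 4 \<in> range (\<lambda>v. A2 *v v)" by blast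
      qed
    qed (unfold A2, blast)
    finally show ?thesis .
  qed
  moreover have "{u. A2 *v u = 0} = range (\<lambda>v. A3 *v v)"
  proof -
    have ker: "A2 *v u = 0 \<longleftrightarrow> (\<exists>h. u $ 1 = h * a 1 \<and> u $ 2 = h * a 2 \<and> u $ 3 = h * a 3 \<and> u $ 4 = h * a 4)" for u
    proof -
      define b where "b = (\<lambda>i::nat. u $ (of_nat i))"
      have "A2 *v u = (\<Sum>i=1..4. b i *s r i)" by (simp add: A2 sum_1_4 b_def)
      then show ?thesis using a(1) unfolding generates_relations_def ball_1_4 by (simp add: b_def)
    qed
    have im: "u = A3 *v v \<longleftrightarrow> u $ 1 = v $ 1 * a 1 \<and> u $ 2 = v $ 1 * a 2 \<and> u $ 3 = v $ 1 * a 3 \<and> u $ 4 = v $ 1 * a 4" for u v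
      by (simp add: A3 vec_eq_iff forall_4 vector_4)
    show ?thesis
    proof
      show "{u. A2 *v u = 0} \<subseteq> range (\<lambda>v. A3 *v v)"
      proof
        fix u assume "u \<in> {u. A2 *v u = 0}"
        then obtain h where "u $ 1 = h * a 1 \<and> u $ 2 = h * a 2 \<and> u $ 3 = h * a 3 \<and> u $ 4 = h * a 4"
          unfolding ker by blast
        then have "u = A3 *v (vec h)" unfolding im by simp
        then show "u \<in> range (\<lambda>v. A3 *v v)" by blast
      qed
      show "range (\<lambda>v. A3 *v v) \<subseteq> {u. A2 *v u = 0}"
        using im ker by blast
    qed
  qed
  moreover have "inj (\<lambda>v. A3 *v v)"
  proof (rule injI)
    fix v w assume "A3 *v v = A3 *v w"
    then have "v $ 1 * a 1 = w $ 1 * a 1" "v $ 1 * a 2 = w $ 1 * a 2"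
        "v $ 1 * a 3 = w $ 1 * a 3" "v $ 1 * a 4 = w $ 1 * a 4"
      unfolding A3 vec_eq_iff forall_4 by (simp_all add: vector_4)
    moreover have "a 1 \<noteq> 0 \<or> a 2 \<noteq> 0 \<or> a 3 \<noteq> 0 \<or> a 4 \<noteq> 0"
      using a(3) ball_1_4[of "\<lambda>i. a i = 0"] by blast
    ultimately have "v $ 1 = w $ 1" by auto
    then show "v = w" by (simp add: vec_eq_iff forall_1)
  qed
  ultimately show ?thesis unfolding has_minimal_resolution_def by blast
qed

lemma generates_relations_unit_multiple:
  assumes "generates_relations r a" "c dvd 1"
  shows "generates_relations r (\<lambda>i. c * a i)"
proof -
  obtain c' where c': "1 = c * c'" using assms(2) by (rule dvdE)
  have "(\<exists>h. \<forall>i\<in>{1..4}. b i = h * a i) \<longleftrightarrow> (\<exists>h. \<forall>i\<in>{1..4}. b i = h * (c * a i))" for b :: "nat \<Rightarrow> S"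
  proof
    assume "\<exists>h. \<forall>i\<in>{1..4}. b i = h * a i"
    then obtain h where h: "\<forall>i\<in>{1..4}. b i = h * a i" by blast
    have "h * a i = h * c' * (c * a i)" for i
    proof -
      have "h * c' * (c * a i) = c * c' * (h * a i)" by (simp only: ac_simps)
      then show ?thesis by (simp flip: c')
    qed
    with h show "\<exists>h. \<forall>i\<in>{1..4}. b i = h * (c * a i)" by (intro exI[of _ "h * c'"]) simp
  next
    assume "\<exists>h. \<forall>i\<in>{1..4}. b i = h * (c * a i)"
    then obtain h where "\<forall>i\<in>{1..4}. b i = h * (c * a i)" by blast
    then show "\<exists>h. \<forall>i\<in>{1..4}. b i = h * a i"
      by (intro exI[of _ "h * c"]) (simp add: mult.assoc)
  qed
  then show ?thesis using assms(1) by (simp add: generates_relations_def)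
qed

section \<open>Nearly free surfaces and the determinants of their syzygies\<close>

text \<open>
  In both directions the generators satisfy \<open>phi r i = (-1) ^ i * d * relation i * f\<close>, where \<open>d\<close> is the
  degree of \<open>f\<close>. The direct part compares \<open>relation\<close> with the given generator \<open>a\<close>; in the converse part
  the choice \<open>a = d * relation\<close> absorbs the factor \<open>d\<close>.
\<close>

theorem theorem5p4:
  fixes f :: S and d d1 d2 d3 :: nat and r :: "nat \<Rightarrow> S^4"
  shows
    "(\<forall>a :: nat \<Rightarrow> S.
        nearly_free f d d1 d2 d3 \<and>
        homogeneous_generators r d1 d2 d3 \<and> generates_AR f r \<and>
        homogeneous_relation a d1 d2 d3 \<and> generates_relations r a
        \<longrightarrow> (\<exists>c. c \<noteq> 0 \<and> (\<forall>i\<in>{1..4}. phi r i = (-1) ^ i * Const c * a i * f)))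
     \<and>
     (reduced_surface f d \<and> \<not> is_cone f \<and>
      saturated (jacobian_ideal f) \<and>
      homogeneous_generators r d1 d2 d3 \<and> minimally_generates_AR f r \<and>
      d1 \<le> d2 \<and> d2 \<le> d3 \<and> d1 + d2 + d3 = d
      \<longrightarrow> nearly_free f d d1 d2 d3 \<and>
          (\<exists>a :: nat \<Rightarrow> S.
             (\<forall>i\<in>{1..4}. f dvd phi r i \<and> a i * f = (-1) ^ i * phi r i) \<and>
             homogeneous_relation a d1 d2 d3 \<and> generates_relations r a))"
proof (intro conjI allI impI)
  fix a :: "nat \<Rightarrow> S"
  assume asm: "nearly_free f d d1 d2 d3 \<and>
        homogeneous_generators r d1 d2 d3 \<and> generates_AR f r \<and>
        homogeneous_relation a d1 d2 d3 \<and> generates_relations r a"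
  then have f: "reduced_surface f d" and r: "generates_AR f r" and a: "generates_relations r a"
    by (auto simp: nearly_free_def)
  interpret four_syzygies "\<lambda>j. pdiff j f" r by (rule four_syzygies_gradient[OF f r])
  obtain c where c: "c \<noteq> 0" "\<forall>i\<in>{1..4}. relation i = Const c * a i"
    using generates_relations_unique[OF a] by blast
  have "phi r i = (-1) ^ i * Const (of_nat d * c) * a i * f" if i: "i \<in> {1..4}" for i
  proof -
    have "quotient_minor i = (-1) ^ i * relation i"
      by (simp add: relation_def flip: mult.assoc power_add)
    then show ?thesis
      using c(2) i by (simp add: phi_eq_quotient_minor[OF f r i] Const_mult Const_of_nat algebra_simps)
  qed
  moreover have "of_nat d * c \<noteq> 0" using c(1) f by (auto simp: reduced_surface_def)
  ultimately show "\<exists>c. c \<noteq> 0 \<and> (\<forall>i\<in>{1..4}. phi r i = (-1) ^ i * Const c * a i * f)" by blast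
next
  assume asm: "reduced_surface f d \<and> \<not> is_cone f \<and>
      saturated (jacobian_ideal f) \<and>
      homogeneous_generators r d1 d2 d3 \<and> minimally_generates_AR f r \<and>
      d1 \<le> d2 \<and> d2 \<le> d3 \<and> d1 + d2 + d3 = d"
  then have f: "reduced_surface f d" "\<not> is_cone f" and hom: "homogeneous_generators r d1 d2 d3"
    and r: "generates_AR f r" and deg: "d1 \<le> d2" "d2 \<le> d3" "d1 + d2 + d3 = d"
    by (auto simp: minimally_generates_AR_def)
  interpret four_syzygies "\<lambda>j. pdiff j f" r by (rule four_syzygies_gradient[OF f(1) r])
  define a where "a = (\<lambda>i. of_nat d * relation i)"
  have d: "(of_nat d :: S) dvd 1" "d \<ge> 2"
    using not_cone_degree_ge_2[OF f] by (auto intro: of_nat_dvd_S)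
  have gen: "generates_relations r a"
    unfolding a_def by (rule generates_relations_unit_multiple[OF generates_relations_relation d(1)])
  have hom_a: "homogeneous_relation a d1 d2 d3"
  proof -
    \<comment> \<open>the minor of index \<open>i\<close> has degree \<open>d1 + d2 + d3 + d3 - e i\<close>, of which the gradient takes \<open>d - 1\<close>;
      with \<open>d = d1 + d2 + d3\<close> there remains \<open>d3 - e i + 1\<close>\<close>
    define e :: "nat \<Rightarrow> int" where "e = (\<lambda>i. if i = 1 then d1 else if i = 2 then d2 else d3)"
    have "\<forall>i\<in>{1..4}. homogeneous_vec (e i) (r i)"
      using hom by (simp add: ball_1_4 e_def homogeneous_generators_def)
    moreover have "homogeneous (int d - 1) (pdiff j f)" for j
      using f(1) homogeneous_pdiff by (simp add: reduced_surface_def)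
    ultimately have q: "homogeneous (e 1 + e 2 + e 3 + e 4 - e i - (int d - 1)) (quotient_minor i)"
      if "i \<in> {1..4}" for i
      using homogeneous_quotient_minor that by blast
    have "homogeneous (e 1 + e 2 + e 3 + e 4 - e i - (int d - 1)) (a i)" if "i \<in> {1..4}" for i
    proof -
      have "a i = Const (of_nat d * (-1) ^ i) * quotient_minor i"
      proof -
        have "Const ((-1) ^ i) = (-1) ^ i"
          by (cases "even i") (simp_all add: Const_def single_uminus)
        then show ?thesis by (simp add: a_def relation_def Const_mult Const_of_nat mult.assoc)
      qed
      with homogeneous_mult[OF homogeneous_Const q[OF that]] show ?thesis by simp
    qed
    then have "\<forall>i\<in>{1..4}. homogeneous (e 1 + e 2 + e 3 + e 4 - e i - (int d - 1)) (a i)" by blast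
    then show ?thesis
      unfolding ball_1_4 homogeneous_relation_def using deg by (simp add: e_def algebra_simps flip: deg(3))
  qed
  have phi: "a i * f = (-1) ^ i * phi r i" if "i \<in> {1..4}" for i
    by (simp add: phi_eq_quotient_minor[OF f(1) r that] a_def relation_def algebra_simps)
  have dvd: "f dvd phi r i" if "i \<in> {1..4}" for i
    by (simp add: phi_eq_quotient_minor[OF f(1) r that])
  have d1: "1 \<le> d1"
  proof (rule not_cone_degree_syzygy_pos[OF f(2)])
    show "r 1 \<in> AR f"
      using r module.span_base[OF module_S_vec, of "r 1" "r ` {1..4}"] by (simp add: generates_AR_def)
    have "r 1 \<notin> module.span (*s) (r ` ({1..4} - {1}))"
      using asm by (simp add: minimally_generates_AR_def)
    then show "r 1 \<noteq> 0" using module.span_zero[OF module_S_vec] by metis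
    show "homogeneous_vec (int d1) (r 1)" using hom by (simp add: homogeneous_generators_def)
  qed
  have "\<exists>i\<in>{1..4}. a i \<noteq> 0"
    using relation_nonzero d(2) by (simp add: a_def)
  then have "has_minimal_resolution (jacobian_ideal f)
       (vec (int d - 1) :: int^4)
       (vector [int d1 + (int d - 1), int d2 + (int d - 1),
                int d3 + (int d - 1), int d3 + (int d - 1)] :: int^4)
       (vec (int d3 + int d) :: int^1)"
    by (rule has_minimal_resolution_gradient[OF f(1) d(2) r hom d1 deg(1,2) gen hom_a])
  then show "nearly_free f d d1 d2 d3"
    using f d1 deg by (simp add: nearly_free_def)
  show "\<exists>a :: nat \<Rightarrow> S.
             (\<forall>i\<in>{1..4}. f dvd phi r i \<and> a i * f = (-1) ^ i * phi r i) \<and>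
             homogeneous_relation a d1 d2 d3 \<and> generates_relations r a"
    using phi dvd hom_a gen by blast
qed

end
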